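(* Let $G$ and $H$ be Polish groups such that $H$ is non-archimedean but $G$ is not non-archimedean. Then $E(G)\not\le_B E_H^Y$ for any Polish $H$-space $Y$.
   Context: For a Polish group $G$, $E(G)$ is the equivalence relation on $G^\omega$ defined by $x\,E(G)\,y$ iff $(x(n)y(n)^{-1})_n$ converges in $G$. A Polish group is non-archimedean if it has a neighborhood base of the identity consisting of open subgroups. A Polish $H$-space is a Polish space with a continuous $H$-action; $E_H^Y$ denotes its orbit equivalence relation. $\le_B$ denotes Borel reducibility. *)

theory Defs
  imports "HOL-Analysis.Analysis" "HOL-Algebra.Group_Action"
begin

definition polish_topology :: "'a topology \<Rightarrow> bool" where
  "polish_topology X \<longleftrightarrow> separable_space X \<and> completely_metrizable_space X"

locale polish_group = group G for G (structure) +
  fixes T :: "'a topology"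
  assumes topspace_eq_carrier: "topspace T = carrier G"
    and polish: "polish_topology T"
    and continuous_mult: "continuous_map (prod_topology T T) T (\<lambda>(g, h). g \<otimes> h)"
    and continuous_inv: "continuous_map T T (\<lambda>g. inv g)"

definition non_archimedean :: "('a, 'm) monoid_scheme \<Rightarrow> 'a topology \<Rightarrow> bool" where
  "non_archimedean G T \<longleftrightarrow>
     (\<forall>U. openin T U \<and> \<one>\<^bsub>G\<^esub> \<in> U \<longrightarrow> (\<exists>K. subgroup K G \<and> openin T K \<and> K \<subseteq> U))"

locale polish_H_space =
  polish_group H T + group_action H "topspace Y" \<phi>
  for H (structure) and T :: "'h topology" and Y :: "'y topology" and \<phi> :: "'h \<Rightarrow> 'y \<Rightarrow> 'y" +
  assumes polish_space: "polish_topology Y"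
    and continuous_action: "continuous_map (prod_topology T Y) Y (\<lambda>(h, y). \<phi> h y)"

definition orbit_rel :: "('h, 'm) monoid_scheme \<Rightarrow> 'y topology \<Rightarrow> ('h \<Rightarrow> 'y \<Rightarrow> 'y) \<Rightarrow> 'y rel" where
  "orbit_rel H Y \<phi> = {(y, z). y \<in> topspace Y \<and> z \<in> topspace Y \<and> z \<in> orbit H \<phi> y}"

abbreviation seq_topology :: "'a topology \<Rightarrow> (nat \<Rightarrow> 'a) topology" where
  "seq_topology T \<equiv> product_topology (\<lambda>_. T) UNIV"

text \<open>The relation usually written \<open>E(G)\<close>, on the space of sequences in the group.\<close>

definition group_conv_rel :: "('a, 'm) monoid_scheme \<Rightarrow> 'a topology \<Rightarrow> (nat \<Rightarrow> 'a) rel" where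
  "group_conv_rel G T = {(x, y). x \<in> topspace (seq_topology T) \<and> y \<in> topspace (seq_topology T) \<and>
     (\<exists>l. limitin T (\<lambda>n. x n \<otimes>\<^bsub>G\<^esub> inv\<^bsub>G\<^esub> (y n)) l sequentially)}"

definition borel_of :: "'a topology \<Rightarrow> 'a measure" where
  "borel_of X = sigma (topspace X) {U. openin X U}"

lemma space_borel_of [simp]: "space (borel_of X) = topspace X"
  by (simp add: borel_of_def space_measure_of_conv)

lemma sets_borel_of: "sets (borel_of X) = sigma_sets (topspace X) {U. openin X U}"
  unfolding borel_of_def by (rule sets_measure_of) (auto dest: openin_subset)

definition borel_reducible :: "'a topology \<Rightarrow> 'a rel \<Rightarrow> 'b topology \<Rightarrow> 'b rel \<Rightarrow> bool" where
  "borel_reducible X E Y F \<longleftrightarrow>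
     (\<exists>f \<in> borel_of X \<rightarrow>\<^sub>M borel_of Y.
        \<forall>x \<in> topspace X. \<forall>y \<in> topspace X. (x, y) \<in> E \<longleftrightarrow> (f x, f y) \<in> F)"

end

theory Submission
  imports Defs
begin

text \<open>
  Since \<open>G\<close> is not non-archimedean, some neighbourhood \<open>U\<close> of the identity can be left from
  \<open>\<one>\<close> by a chain \<open>\<one> = c n 0, c n 1, \<dots>\<close> with steps in the \<open>n\<close>-th basic
  neighbourhood. Mapping \<open>x \<in> \<nat>\<^sup>\<nat>\<close> to the sequence of the \<open>c n (x n)\<close>, interleaved with ones,
  makes \<open>x\<close> and \<open>y\<close> equivalent if \<open>|x n - y n| \<le> 1\<close> for almost all \<open>n\<close>, but inequivalent if
  infinitely often one is at the start and the other at the exit of its chain.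

  Let \<open>F\<close> be the composition of this map with a reduction to an orbit relation of a
  non-archimedean \<open>H\<close>. For an open coset \<open>W\<close> of \<open>H\<close>, if \<open>F(y) \<in> W F(x)\<close> for generic adjacent
  \<open>x, y\<close> above given finite stems, then \<open>W W\<^sup>-\<^sup>1 W = W\<close> allows one to compose small steps, so the same
  holds after extending one stem by the start and the other by the exit of the next chain. A Baire
  category argument then shrinks \<open>W\<close>. In the limit the cosets converge to some \<open>h\<close> with
  \<open>F(y) = h F(x)\<close> for an inequivalent pair \<open>x, y\<close>, a contradiction.
\<close>

no_notation eq_closure_of (\<open>closure'_of\<index>\<close>)

section \<open>Baire category in topological spaces\<close>

definition comeager_in :: "'a topology \<Rightarrow> 'a set \<Rightarrow> bool" where
  "comeager_in X A \<longleftrightarrow> (\<exists>\<G>. countable \<G> \<and>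
     (\<forall>U\<in>\<G>. openin X U \<and> X closure_of U = topspace X) \<and> topspace X \<inter> \<Inter>\<G> \<subseteq> A)"

lemma comeager_inE:
  assumes "comeager_in X A"
  obtains \<G> where "countable \<G>" "\<forall>U\<in>\<G>. openin X U \<and> X closure_of U = topspace X"
    "topspace X \<inter> \<Inter>\<G> \<subseteq> A"
  using assms unfolding comeager_in_def by (elim exE conjE) (rule that)

lemma comeager_in_mono:
  assumes "comeager_in X A" "\<And>x. \<lbrakk>x \<in> topspace X; x \<in> A\<rbrakk> \<Longrightarrow> x \<in> B"
  shows "comeager_in X B"
proof -
  obtain \<G> where "countable \<G>" "\<forall>U\<in>\<G>. openin X U \<and> X closure_of U = topspace X"
     "topspace X \<inter> \<Inter>\<G> \<subseteq> A"
    by (rule comeager_inE[OF assms(1)])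
  then show ?thesis
    using assms(2) unfolding comeager_in_def by (intro exI[of _ \<G>]) blast
qed

lemma comeager_in_topspace: "topspace X \<subseteq> A \<Longrightarrow> comeager_in X A"
  unfolding comeager_in_def by (intro exI[of _ "{}"]) auto

lemma comeager_in_dense_open:
  "\<lbrakk>openin X U; X closure_of U = topspace X\<rbrakk> \<Longrightarrow> comeager_in X U"
  unfolding comeager_in_def by (intro exI[of _ "{U}"]) auto

lemma comeager_in_INT:
  assumes "countable I" "\<And>i. i \<in> I \<Longrightarrow> comeager_in X (A i)"
  shows "comeager_in X (\<Inter>i\<in>I. A i)"
proof -
  have "\<forall>i\<in>I. \<exists>\<G>. countable \<G> \<and> (\<forall>U\<in>\<G>. openin X U \<and> X closure_of U = topspace X) \<and>
      topspace X \<inter> \<Inter>\<G> \<subseteq> A i"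
    using assms(2) by (simp add: comeager_in_def)
  then obtain \<G> where G: "\<forall>i\<in>I. countable (\<G> i) \<and>
     (\<forall>U\<in>\<G> i. openin X U \<and> X closure_of U = topspace X) \<and> topspace X \<inter> \<Inter>(\<G> i) \<subseteq> A i"
    by (rule bchoice[THEN exE])
  have "countable (\<Union>i\<in>I. \<G> i)"
    using G assms(1) by simp
  moreover have "topspace X \<inter> \<Inter>(\<Union>i\<in>I. \<G> i) \<subseteq> (\<Inter>i\<in>I. A i)"
  proof (intro subsetI INT_I)
    fix x i assume x: "x \<in> topspace X \<inter> \<Inter>(\<Union>i\<in>I. \<G> i)" and i: "i \<in> I"
    then have "x \<in> topspace X \<inter> \<Inter>(\<G> i)"
      by auto
    then show "x \<in> A i"
      using bspec[OF G i] by (elim conjE) (rule subsetD)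
  qed
  moreover have "\<forall>U\<in>(\<Union>i\<in>I. \<G> i). openin X U \<and> X closure_of U = topspace X"
    using G by simp
  ultimately show ?thesis
    unfolding comeager_in_def by (intro exI[of _ "\<Union>i\<in>I. \<G> i"] conjI)
qed

lemma comeager_in_Int:
  assumes "comeager_in X A" "comeager_in X B"
  shows "comeager_in X (A \<inter> B)"
proof -
  have "comeager_in X (\<Inter>i\<in>{A, B}. i)"
    using assms by (intro comeager_in_INT) auto
  then show ?thesis by simp
qed

text \<open>An open map carries a nonempty open set to a nonempty open set, which meets the dense
  \<open>U\<close>. Genericity is transferred between different sequence spaces in this way.\<close>

lemma dense_open_vimage:
  assumes p: "continuous_map X X' p" "open_map X X' p"
    and U: "openin X' U" "X' closure_of U = topspace X'"
  shows "openin X {x \<in> topspace X. p x \<in> U}"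
    and "X closure_of {x \<in> topspace X. p x \<in> U} = topspace X"
proof -
  show "openin X {x \<in> topspace X. p x \<in> U}"
    using p(1) U(1) by (rule openin_continuous_map_preimage)
  show "X closure_of {x \<in> topspace X. p x \<in> U} = topspace X"
    unfolding dense_intersects_open
  proof (intro allI impI, elim conjE)
    fix V assume V: "openin X V" "V \<noteq> {}"
    then have "openin X' (p ` V)" "p ` V \<noteq> {}"
      using p(2) by (auto simp: open_map_def)
    then have "U \<inter> p ` V \<noteq> {}"
      using U(2) unfolding dense_intersects_open by blast
    then show "{x \<in> topspace X. p x \<in> U} \<inter> V \<noteq> {}"
      using openin_subset[OF V(1)] by blast
  qed
qed

lemma comeager_in_vimage:
  assumes p: "continuous_map X X' p" "open_map X X' p" and A: "comeager_in X' A"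
  shows "comeager_in X {x. p x \<in> A}"
proof -
  obtain \<G> where G: "countable \<G>" "\<forall>U\<in>\<G>. openin X' U \<and> X' closure_of U = topspace X'"
     "topspace X' \<inter> \<Inter>\<G> \<subseteq> A"
    by (rule comeager_inE[OF A])
  have "comeager_in X (\<Inter>U\<in>\<G>. {x \<in> topspace X. p x \<in> U})"
    using G dense_open_vimage[OF p] by (intro comeager_in_INT comeager_in_dense_open) auto
  then show ?thesis
    by (rule comeager_in_mono) (use G(3) p(1) in \<open>auto simp: continuous_map_def\<close>)
qed

lemma comeager_in_meets_open:
  assumes "completely_metrizable_space X" "comeager_in X A" "openin X V" "V \<noteq> {}"
  shows "V \<inter> A \<noteq> {}"
proof -
  obtain \<G> where G: "countable \<G>" "\<forall>U\<in>\<G>. openin X U \<and> X closure_of U = topspace X"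
     "topspace X \<inter> \<Inter>\<G> \<subseteq> A"
    by (rule comeager_inE[OF assms(2)])
  have "X closure_of \<Inter>\<G> = topspace X"
    using assms(1) G by (intro Baire_category) auto
  then have "\<Inter>\<G> \<inter> V \<noteq> {}"
    using assms(3,4) unfolding dense_intersects_open by blast
  then show ?thesis
    using G(3) openin_subset[OF assms(3)] by blast
qed

section \<open>Sets with the Baire property\<close>

definition baire_property :: "'a topology \<Rightarrow> 'a set \<Rightarrow> bool" where
  "baire_property X A \<longleftrightarrow> (\<exists>U. openin X U \<and> comeager_in X {x. x \<in> A \<longleftrightarrow> x \<in> U})"

lemma baire_property_openin: "openin X U \<Longrightarrow> baire_property X U"
  unfolding baire_property_def by (intro exI[of _ U]) (auto intro: comeager_in_topspace)

lemma baire_property_cong: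
  assumes "baire_property X A" "comeager_in X {x. x \<in> A \<longleftrightarrow> x \<in> B}"
  shows "baire_property X B"
proof -
  obtain U where U: "openin X U" "comeager_in X {x. x \<in> A \<longleftrightarrow> x \<in> U}"
    using assms(1) unfolding baire_property_def by blast
  have "comeager_in X {x. x \<in> B \<longleftrightarrow> x \<in> U}"
    by (rule comeager_in_mono[OF comeager_in_Int[OF U(2) assms(2)]]) auto
  then show ?thesis
    using U(1) unfolding baire_property_def by blast
qed

text \<open>The complement of an open \<open>U\<close> differs from its exterior \<open>V\<close>
  only by the boundary of \<open>U\<close>, which is nowhere dense.\<close>

lemma baire_property_compl:
  assumes "baire_property X A"
  shows "baire_property X (topspace X - A)"
proof -
  obtain U where U: "openin X U" "comeager_in X {x. x \<in> A \<longleftrightarrow> x \<in> U}"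
    using assms unfolding baire_property_def by blast
  define V where "V = topspace X - X closure_of U"
  have "openin X V"
    unfolding V_def by (intro openin_diff openin_topspace closedin_closure_of)
  have "X closure_of (U \<union> V) = topspace X"
    unfolding dense_intersects_open
  proof (intro allI impI, elim conjE)
    fix W assume W: "openin X W" "W \<noteq> {}"
    then obtain w where w: "w \<in> W" "w \<in> topspace X"
      using openin_subset by blast
    show "(U \<union> V) \<inter> W \<noteq> {}"
    proof (cases "w \<in> X closure_of U")
      case True
      then show ?thesis using W w unfolding in_closure_of by blast
    next
      case False
      then show ?thesis using w unfolding V_def by blast
    qed
  qed
  then have "comeager_in X (U \<union> V)"
    using U(1) \<open>openin X V\<close> by (intro comeager_in_dense_open) auto
  then have "comeager_in X {x. x \<in> topspace X - A \<longleftrightarrow> x \<in> V}"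
    using closure_of_subset[OF openin_subset[OF U(1)]]
    by - (rule comeager_in_mono[OF comeager_in_Int[OF U(2)]], assumption, auto simp: V_def)
  then show ?thesis
    using \<open>openin X V\<close> unfolding baire_property_def by blast
qed

lemma baire_property_UN:
  assumes "countable I" "\<And>i. i \<in> I \<Longrightarrow> baire_property X (A i)"
  shows "baire_property X (\<Union>i\<in>I. A i)"
proof -
  obtain U where U: "\<And>i. i \<in> I \<Longrightarrow> openin X (U i)"
      "\<And>i. i \<in> I \<Longrightarrow> comeager_in X {x. x \<in> A i \<longleftrightarrow> x \<in> U i}"
    using assms(2) unfolding baire_property_def by metis
  have "comeager_in X (\<Inter>i\<in>I. {x. x \<in> A i \<longleftrightarrow> x \<in> U i})"
    using assms(1) U by (intro comeager_in_INT) auto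
  then have "comeager_in X {x. x \<in> (\<Union>i\<in>I. A i) \<longleftrightarrow> x \<in> (\<Union>i\<in>I. U i)}"
    by (rule comeager_in_mono) auto
  moreover have "openin X (\<Union>i\<in>I. U i)"
    using U by auto
  ultimately show ?thesis
    unfolding baire_property_def by blast
qed

lemma baire_property_INT_openin:
  assumes "countable I" "\<And>i. i \<in> I \<Longrightarrow> openin X (A i)"
  shows "baire_property X (topspace X \<inter> (\<Inter>i\<in>I. A i))"
proof -
  have "baire_property X (topspace X - (\<Union>i\<in>I. topspace X - A i))"
    using assms by (intro baire_property_compl baire_property_UN baire_property_openin) auto
  moreover have "topspace X - (\<Union>i\<in>I. topspace X - A i) = topspace X \<inter> (\<Inter>i\<in>I. A i)"
    by auto
  ultimately show ?thesis by simp
qed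

lemma baire_property_borel:
  assumes "A \<in> sets (borel_of X)"
  shows "baire_property X A"
  using assms unfolding sets_borel_of
proof (induction rule: sigma_sets.induct)
  case (Union a)
  show ?case using Union.IH by (intro baire_property_UN) auto
qed (simp_all add: baire_property_openin baire_property_compl)

text \<open>Localization: the open set that agrees with \<open>A\<close> up to a meager set cannot
  be empty.\<close>

lemma baire_property_nonmeager:
  assumes "baire_property X A" "\<not> comeager_in X {x. x \<notin> A}"
  obtains U where "openin X U" "U \<noteq> {}" "comeager_in X {x. x \<in> U \<longrightarrow> x \<in> A}"
proof -
  obtain U where U: "openin X U" "comeager_in X {x. x \<in> A \<longleftrightarrow> x \<in> U}"
    using assms(1) unfolding baire_property_def by blast
  have "U \<noteq> {}"
    using U(2) assms(2) by auto
  moreover have "comeager_in X {x. x \<in> U \<longrightarrow> x \<in> A}"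
    by (rule comeager_in_mono[OF U(2)]) auto
  ultimately show ?thesis
    using that U(1) by blast
qed

text \<open>The complement of \<open>N A\<close> below is the set of points at which \<open>A\<close> is locally nonmeager;
  outside a meager set, membership in it can be propagated along a branch of the scheme.\<close>

lemma baire_property_souslin_scheme:
  fixes A :: "nat list \<Rightarrow> 'a set"
  assumes sc: "second_countable X"
    and sub: "\<And>s. A s \<subseteq> (\<Union>i. A (s @ [i]))"
    and M: "comeager_in X M"
    and branch: "\<And>b x. \<lbrakk>x \<in> M; \<And>n. x \<in> X closure_of A (map b [0..<n])\<rbrakk> \<Longrightarrow> x \<in> A []"
  shows "baire_property X (A [])"
proof -
  obtain \<B> where B: "countable \<B>" "\<forall>V \<in> \<B>. openin X V"
     "\<forall>U x. openin X U \<and> x \<in> U \<longrightarrow> (\<exists>V \<in> \<B>. x \<in> V \<and> V \<subseteq> U)"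
    using sc unfolding second_countable_def by (elim exE conjE) (rule that)
  \<comment> \<open>\<open>N C\<close> is the largest open set on which \<open>C\<close> is meager.
    Taking the union over a countable base keeps \<open>C\<close> meager on all of it.\<close>
  define N where "N C = \<Union>{V \<in> \<B>. comeager_in X {x. x \<in> V \<longrightarrow> x \<notin> C}}" for C
  have N_open: "openin X (N C)" for C
    unfolding N_def using B(2) by auto
  have N_meager: "comeager_in X {x. x \<in> N C \<longrightarrow> x \<notin> C}" for C
  proof -
    have "comeager_in X (\<Inter>V\<in>{V \<in> \<B>. comeager_in X {x. x \<in> V \<longrightarrow> x \<notin> C}}. {x. x \<in> V \<longrightarrow> x \<notin> C})"
      using B(1) by (intro comeager_in_INT) auto
    then show ?thesis
      by (rule comeager_in_mono) (auto simp: N_def)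
  qed
  have N_max: "U \<subseteq> N C" if "openin X U" "comeager_in X {x. x \<in> U \<longrightarrow> x \<notin> C}" for U C
  proof
    fix x assume "x \<in> U"
    then obtain V where V: "V \<in> \<B>" "x \<in> V" "V \<subseteq> U"
      using B(3) \<open>openin X U\<close> by metis
    have "comeager_in X {x. x \<in> V \<longrightarrow> x \<notin> C}"
      by (rule comeager_in_mono[OF that(2)]) (use V(3) in auto)
    then show "x \<in> N C"
      using V unfolding N_def by auto
  qed
  have N_closure: "x \<in> X closure_of C" if x: "x \<in> topspace X" "x \<notin> N C" for x C
  proof (rule ccontr)
    assume "x \<notin> X closure_of C"
    then obtain U where U: "openin X U" "x \<in> U" "U \<inter> C = {}"
      using x(1) unfolding in_closure_of by blast
    then have "U \<subseteq> N C"
      by (intro N_max[OF _ comeager_in_topspace]) auto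
    then show False using U(2) x(2) by blast
  qed
  have step: "comeager_in X {x. (\<forall>i. x \<in> N (A (s @ [i]))) \<longrightarrow> x \<in> N (A s)}" for s
  proof -
    \<comment> \<open>\<open>T\<close>, a countable intersection of open sets, agrees with an open
      \<open>U\<close> up to a meager set. The sets \<open>A (s @ [i])\<close> cover
      \<open>A s\<close>, so \<open>A s\<close> is meager on \<open>U\<close>, and maximality gives
      \<open>U \<subseteq> N (A s)\<close>.\<close>
    define T where "T = topspace X \<inter> (\<Inter>i. N (A (s @ [i])))"
    have "baire_property X T"
      unfolding T_def using N_open by (intro baire_property_INT_openin) auto
    then obtain U where U: "openin X U" "comeager_in X {x. x \<in> T \<longleftrightarrow> x \<in> U}"
      unfolding baire_property_def by blast
    have "comeager_in X (\<Inter>i. {x. x \<in> N (A (s @ [i])) \<longrightarrow> x \<notin> A (s @ [i])})"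
      using N_meager by (intro comeager_in_INT) auto
    then have "comeager_in X {x. x \<in> U \<longrightarrow> x \<notin> A s}"
      using sub[of s]
      by - (rule comeager_in_mono[OF comeager_in_Int[OF U(2)]], assumption, auto simp: T_def)
    then have "U \<subseteq> N (A s)"
      by (intro N_max U)
    then show ?thesis
      by - (rule comeager_in_mono[OF U(2)], auto simp: T_def)
  qed
  have "comeager_in X (\<Inter>s. {x. (\<forall>i. x \<in> N (A (s @ [i]))) \<longrightarrow> x \<in> N (A s)})"
    using step by (intro comeager_in_INT) auto
  then have "comeager_in X (M \<inter> ((\<Inter>s. {x. (\<forall>i. x \<in> N (A (s @ [i]))) \<longrightarrow> x \<in> N (A s)})
      \<inter> {x. x \<in> N (A []) \<longrightarrow> x \<notin> A []}))"
    using M N_meager by (intro comeager_in_Int) auto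
  then have "comeager_in X {x. x \<in> topspace X - N (A []) \<longleftrightarrow> x \<in> A []}"
  proof (rule comeager_in_mono, clarify)
    fix x assume x: "x \<in> topspace X" "x \<in> M" "x \<in> N (A []) \<longrightarrow> x \<notin> A []"
      and s: "x \<in> (\<Inter>s. {x. (\<forall>i. x \<in> N (A (s @ [i]))) \<longrightarrow> x \<in> N (A s)})"
    have "x \<in> A []" if "x \<notin> N (A [])"
    proof -
      \<comment> \<open>Off the exceptional sets, a point outside \<open>N (A s)\<close> is outside
        \<open>N (A (s @ [i]))\<close> for some \<open>i\<close>. Iterating from \<open>[]\<close>
        yields a branch along which \<open>x\<close> lies in every closure.\<close>
      obtain j where j: "\<And>s. x \<notin> N (A s) \<Longrightarrow> x \<notin> N (A (s @ [j s]))"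
        using s by (simp add: INT_iff) metis
      define p where "p = rec_nat [] (\<lambda>_ s. s @ [j s])"
      have p: "p 0 = []" "p (Suc n) = p n @ [j (p n)]" for n
        by (simp_all add: p_def)
      have "p n = map (\<lambda>n. j (p n)) [0..<n]" for n
        by (induction n) (auto simp: p)
      moreover have "x \<notin> N (A (p n))" for n
        by (induction n) (auto simp: p that j)
      ultimately show "x \<in> A []"
        using branch[of x "\<lambda>n. j (p n)"] N_closure x by metis
    qed
    then show "x \<in> topspace X - N (A []) \<longleftrightarrow> x \<in> A []"
      using x by auto
  qed
  then show ?thesis
    by (rule baire_property_cong[OF baire_property_compl[OF baire_property_openin[OF N_open]]])
qed

section \<open>Polish spaces\<close>

text \<open>The balls of radius \<open>1 / 2 ^ k\<close> around a countable dense set serve as the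
  \<open>k\<close>-th cover. Completeness becomes the last clause, since a sequence that eventually
  stays in one member of each cover is Cauchy; later limit arguments then need no metric.\<close>

lemma polish_topology_covers:
  fixes T :: "'a topology"
  assumes "polish_topology T"
  obtains B :: "nat \<Rightarrow> nat \<Rightarrow> 'a set" where
    "\<And>k i. openin T (B k i)" "\<And>k. topspace T \<subseteq> (\<Union>i. B k i)"
    "\<And>U x. \<lbrakk>openin T U; x \<in> U\<rbrakk> \<Longrightarrow> \<exists>k i. x \<in> B k i \<and> B k i \<subseteq> U"
    "\<forall>b g. (\<forall>k n. k \<le> n \<longrightarrow> g n \<in> B k (b k)) \<longrightarrow> (\<exists>l. limitin T g l sequentially)"
proof (cases "topspace T = {}")
  case True
  then show ?thesis
    using openin_subset[of T] by (intro that[of "\<lambda>_ _. {}"]) auto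
next
  case False
  obtain M d where "Metric_space M d" and mc: "Metric_space.mcomplete M d"
    and T: "T = Metric_space.mtopology M d"
    using assms unfolding polish_topology_def completely_metrizable_space_def by blast
  then interpret Metric_space M d by simp
  obtain C where C: "countable C" "C \<subseteq> M" "mtopology closure_of C = M"
    using assms unfolding polish_topology_def separable_space_def T by auto
  define B where "B k i = mball (from_nat_into C i) (1 / 2 ^ k)" for k i :: nat
  have C_dense: "\<exists>i. from_nat_into C i \<in> M \<and> d (from_nat_into C i) x < e" if x: "x \<in> M" and e: "e > 0" for x e
  proof -
    have "x \<in> mtopology closure_of C"
      using C x by simp
    then obtain c where "c \<in> C" "c \<in> mball x e"
      using e unfolding metric_closure_of by blast
    then show ?thesis
      using C(1,2) by (metis commute from_nat_into_surj in_mball)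
  qed
  show ?thesis
  proof
    show "openin T (B k i)" for k i
      unfolding T B_def by simp
    show "topspace T \<subseteq> (\<Union>i. B k i)" for k
      using C_dense[of _ "1 / 2 ^ k"] by (auto simp: B_def T)
    show "\<exists>k i. x \<in> B k i \<and> B k i \<subseteq> U" if U: "openin T U" "x \<in> U" for U x
    proof -
      have x: "x \<in> M" using U openin_subset T by fastforce
      obtain r where r: "r > 0" "mball x r \<subseteq> U"
        using U unfolding T openin_mtopology by blast
      obtain k where k: "1 / 2 ^ k < r / 2"
        using real_arch_pow_inv[of "r/2" "1/2"] r(1) by (auto simp: power_one_over)
      obtain i where i: "from_nat_into C i \<in> M" "d (from_nat_into C i) x < 1 / 2 ^ k"
        using C_dense[OF x, of "1 / 2 ^ k"] by auto
      have "B k i \<subseteq> mball x r"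
        using k i x triangle commute unfolding B_def
        by (smt (verit) field_sum_of_halves in_mball subsetI)
      then show ?thesis
        using i r x by (intro exI[of _ k] exI[of _ i]) (auto simp: B_def)
    qed
    show "\<forall>b g. (\<forall>k n. k \<le> n \<longrightarrow> g n \<in> B k (b k)) \<longrightarrow> (\<exists>l. limitin T g l sequentially)"
    proof (intro allI impI)
      fix b g assume "\<forall>k n. k \<le> n \<longrightarrow> g n \<in> B k (b k)"
      then have g: "\<And>k n. k \<le> n \<Longrightarrow> g n \<in> B k (b k)"
        by blast
      have "MCauchy g"
        unfolding MCauchy_def
      proof (intro conjI allI impI)
        show "range g \<subseteq> M"
          using g[of 0] by (auto simp: B_def)
        fix e :: real assume "e > 0"
        then obtain k where k: "1 / 2 ^ k < e / 2"
          using real_arch_pow_inv[of "e/2" "1/2"] by (auto simp: power_one_over)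
        have "d (g n) (g n') < e" if "k \<le> n" "k \<le> n'" for n n'
          using g[OF that(1)] g[OF that(2)] k triangle[of "g n" "from_nat_into C (b k)" "g n'"]
          by (auto simp: B_def commute)
        then show "\<exists>N. \<forall>n n'. N \<le> n \<longrightarrow> N \<le> n' \<longrightarrow> d (g n) (g n') < e"
          by blast
      qed
      then show "\<exists>l. limitin T g l sequentially"
        using mc unfolding mcomplete_def T by blast
    qed
  qed
qed

lemma polish_topology_second_countable:
  assumes "polish_topology T"
  shows "second_countable T"
proof -
  obtain B :: "nat \<Rightarrow> nat \<Rightarrow> 'a set" where B: "\<And>k i. openin T (B k i)"
    "\<And>U x. \<lbrakk>openin T U; x \<in> U\<rbrakk> \<Longrightarrow> \<exists>k i. x \<in> B k i \<and> B k i \<subseteq> U"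
    by (rule polish_topology_covers[OF assms]) (rule that)
  show ?thesis
    unfolding second_countable_def
  proof (intro exI[of _ "range (case_prod B)"] conjI allI impI)
    fix U x assume "openin T U \<and> x \<in> U"
    then obtain k i where "x \<in> B k i" "B k i \<subseteq> U"
      using B(2) by metis
    then show "\<exists>V\<in>range (case_prod B). x \<in> V \<and> V \<subseteq> U"
      by (intro bexI[of _ "case_prod B (k, i)"]) auto
  qed (auto simp: B(1))
qed

lemma polish_topology_Hausdorff: "polish_topology T \<Longrightarrow> Hausdorff_space T"
  unfolding polish_topology_def
  by (simp add: completely_metrizable_imp_metrizable_space metrizable_imp_Hausdorff_space)

section \<open>Products of discrete spaces\<close>

text \<open>The factors may vary with \<open>n\<close>: freezing a finite stem means taking
  singletons there, so a cylinder is again a space of this form.\<close>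

definition seq_space :: "(nat \<Rightarrow> 'a set) \<Rightarrow> (nat \<Rightarrow> 'a) topology" where
  "seq_space S = product_topology (\<lambda>n. discrete_topology (S n)) UNIV"

lemma in_topspace_seq_space [simp]: "x \<in> topspace (seq_space S) \<longleftrightarrow> (\<forall>n. x n \<in> S n)"
  by (auto simp: seq_space_def PiE_iff)

lemma completely_metrizable_seq_space: "completely_metrizable_space (seq_space S)"
  unfolding seq_space_def completely_metrizable_space_product_topology
  by (simp add: completely_metrizable_space_discrete_topology)

lemma openin_seq_space:
  "openin (seq_space S) U \<longleftrightarrow> U \<subseteq> topspace (seq_space S) \<and>
    (\<forall>x\<in>U. \<exists>n. \<forall>y. (\<forall>m. y m \<in> S m) \<and> (\<forall>m<n. y m = x m) \<longrightarrow> y \<in> U)"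
  (is "?L \<longleftrightarrow> ?R")
proof
  assume L: ?L
  show ?R
  proof (intro conjI ballI)
    show "U \<subseteq> topspace (seq_space S)"
      using L by (rule openin_subset)
    fix x assume "x \<in> U"
    then obtain W where W: "finite {i. W i \<noteq> S i}" "x \<in> Pi\<^sub>E UNIV W" "Pi\<^sub>E UNIV W \<subseteq> U"
      using L unfolding seq_space_def openin_product_topology_alt by auto
    obtain n where n: "\<And>i. W i \<noteq> S i \<Longrightarrow> i < n"
      using W(1) unfolding finite_nat_set_iff_bounded by blast
    have "y \<in> U" if "\<forall>m. y m \<in> S m" "\<forall>m<n. y m = x m" for y
    proof -
      have "y m \<in> W m" for m
        using that n[of m] W(2) by (cases "m < n") (auto simp: PiE_iff)
      then show ?thesis using W(3) by (auto simp: PiE_iff)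
    qed
    then show "\<exists>n. \<forall>y. (\<forall>m. y m \<in> S m) \<and> (\<forall>m<n. y m = x m) \<longrightarrow> y \<in> U"
      by blast
  qed
next
  assume R: ?R
  show ?L
    unfolding seq_space_def openin_product_topology_alt
  proof
    fix x assume x: "x \<in> U"
    then obtain n where n: "\<And>y. (\<forall>m. y m \<in> S m) \<Longrightarrow> (\<forall>m<n. y m = x m) \<Longrightarrow> y \<in> U"
      using R by blast
    have xS: "x m \<in> S m" for m
      using R x by auto
    define W where "W i = (if i < n then {x i} else S i)" for i
    have "finite {i. W i \<noteq> S i}"
      by (rule finite_subset[of _ "{..<n}"]) (auto simp: W_def split: if_splits)
    moreover have "Pi\<^sub>E UNIV W \<subseteq> U"
    proof
      fix y assume "y \<in> Pi\<^sub>E UNIV W"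
      then have y: "y m \<in> W m" for m by (auto simp: PiE_iff)
      show "y \<in> U"
      proof (intro n allI impI)
        show "y m \<in> S m" for m
          using y[of m] xS[of m] by (auto simp: W_def split: if_splits)
        show "y m = x m" if "m < n" for m
          using y[of m] that by (auto simp: W_def)
      qed
    qed
    ultimately show "\<exists>W. finite {i \<in> UNIV. W i \<noteq> topspace (discrete_topology (S i))} \<and>
        (\<forall>i\<in>UNIV. openin (discrete_topology (S i)) (W i)) \<and> x \<in> Pi\<^sub>E UNIV W \<and> Pi\<^sub>E UNIV W \<subseteq> U"
      using xS by (intro exI[of _ W]) (auto simp: W_def)
  qed
qed

lemma openin_seq_space_cylinder_subset:
  assumes "openin (seq_space S) U" "x \<in> U"
  shows "\<exists>n. \<forall>y\<in>topspace (seq_space S). (\<forall>m<n. y m = x m) \<longrightarrow> y \<in> U"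
  using assms unfolding openin_seq_space Ball_def in_topspace_seq_space by meson

lemma openin_seq_space_cylinder:
  "openin (seq_space S) {y \<in> topspace (seq_space S). \<forall>m<n. y m = x m}"
  unfolding openin_seq_space by (intro conjI ballI exI[of _ n]) auto

lemma second_countable_seq_space:
  fixes S :: "nat \<Rightarrow> 'a::countable set"
  shows "second_countable (seq_space S)"
proof -
  define B where "B l = {y \<in> topspace (seq_space S). \<forall>m<length l. y m = l ! m}" for l
  show ?thesis
    unfolding second_countable_def
  proof (intro exI[of _ "range B"] conjI allI impI ballI)
    show "openin (seq_space S) V" if "V \<in> range B" for V
      using that openin_seq_space_cylinder[of S] unfolding B_def by auto
    fix U x assume U: "openin (seq_space S) U \<and> x \<in> U"
    then obtain n where n: "\<And>y. (\<forall>m. y m \<in> S m) \<Longrightarrow> (\<forall>m<n. y m = x m) \<Longrightarrow> y \<in> U"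
      unfolding openin_seq_space by blast
    have "x \<in> topspace (seq_space S)"
      using U openin_subset by blast
    then show "\<exists>V\<in>range B. x \<in> V \<and> V \<subseteq> U"
      using n by (intro bexI[OF _ rangeI[of B "map x [0..<n]"]]) (auto simp: B_def)
  qed simp
qed

lemma closure_of_seq_space:
  assumes "x \<in> seq_space S closure_of A"
  obtains y where "y \<in> A" "\<forall>m<n. y m = x m"
proof -
  have meets: "\<exists>y. y \<in> A \<and> y \<in> V" if "x \<in> V" "openin (seq_space S) V" for V
    using assms that unfolding in_closure_of by blast
  have "x \<in> {y \<in> topspace (seq_space S). \<forall>m<n. y m = x m}"
    using assms unfolding in_closure_of by auto
  from meets[OF this openin_seq_space_cylinder] show ?thesis
    using that by auto
qed

lemma limitin_seq_space:
  assumes "\<And>n. x n \<in> S n" "\<And>i n. z i n \<in> S n" "\<And>i n. n < i \<Longrightarrow> z i n = x n"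
  shows "limitin (seq_space S) z x sequentially"
  unfolding limitin_sequentially
proof (intro conjI allI impI)
  fix U assume "openin (seq_space S) U \<and> x \<in> U"
  then obtain n where "\<And>y. (\<forall>m. y m \<in> S m) \<Longrightarrow> (\<forall>m<n. y m = x m) \<Longrightarrow> y \<in> U"
    unfolding openin_seq_space by blast
  then show "\<exists>N. \<forall>n\<ge>N. z n \<in> U"
    using assms by (intro exI[of _ n]) auto
qed (use assms in auto)

section \<open>Continuous and open coordinatewise maps\<close>

lemma coordinatewise_continuous_map:
  assumes "\<And>n a. a \<in> S n \<Longrightarrow> p n a \<in> S' n"
  shows "continuous_map (seq_space S) (seq_space S') (\<lambda>x n. p n (x n))"
  unfolding continuous_map_def
proof (intro conjI allI impI)
  fix U assume U: "openin (seq_space S') U"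
  show "openin (seq_space S) {x \<in> topspace (seq_space S). (\<lambda>n. p n (x n)) \<in> U}"
    unfolding openin_seq_space
  proof (intro conjI ballI)
    fix x assume "x \<in> {x \<in> topspace (seq_space S). (\<lambda>n. p n (x n)) \<in> U}"
    then obtain n where "\<And>y. (\<forall>m. y m \<in> S' m) \<Longrightarrow> (\<forall>m<n. y m = p m (x m)) \<Longrightarrow> y \<in> U"
      using U unfolding openin_seq_space by fast
    then show "\<exists>n. \<forall>y. (\<forall>m. y m \<in> S m) \<and> (\<forall>m<n. y m = x m) \<longrightarrow>
        y \<in> {x \<in> topspace (seq_space S). (\<lambda>n. p n (x n)) \<in> U}"
      using assms by (intro exI[of _ n]) auto
  qed auto
qed (use assms in auto)

text \<open>Surjectivity is required only from \<open>N\<close> on: the factors being discrete, a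
  point close enough to the image of \<open>x\<close> agrees with it on the earlier coordinates,
  where those of \<open>x\<close> serve as a lift.\<close>

lemma coordinatewise_open_map:
  assumes sub: "\<And>n a. a \<in> S n \<Longrightarrow> p n a \<in> S' n"
    and surj: "\<And>n b. \<lbrakk>N \<le> n; b \<in> S' n\<rbrakk> \<Longrightarrow> \<exists>a\<in>S n. p n a = b"
  shows "open_map (seq_space S) (seq_space S') (\<lambda>x n. p n (x n))"
  unfolding open_map_def
proof (intro allI impI)
  fix U assume U: "openin (seq_space S) U"
  show "openin (seq_space S') ((\<lambda>x n. p n (x n)) ` U)"
    unfolding openin_seq_space
  proof (intro conjI ballI)
    show "(\<lambda>x n. p n (x n)) ` U \<subseteq> topspace (seq_space S')"
      using openin_subset[OF U] sub by fastforce
    fix x' assume "x' \<in> (\<lambda>x n. p n (x n)) ` U"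
    then obtain x where x: "x \<in> U" "x' = (\<lambda>n. p n (x n))" by blast
    have xS: "\<And>n. x n \<in> S n"
      using openin_subset[OF U] x(1) by auto
    obtain n where n: "\<And>y. (\<forall>m. y m \<in> S m) \<Longrightarrow> (\<forall>m<n. y m = x m) \<Longrightarrow> y \<in> U"
      using U x(1) unfolding openin_seq_space by blast
    have "y' \<in> (\<lambda>x n. p n (x n)) ` U" if y': "\<forall>m. y' m \<in> S' m" "\<forall>m<max n N. y' m = x' m" for y'
    proof -
      have "\<exists>a\<in>S m. p m a = y' m \<and> (m < n \<longrightarrow> a = x m)" for m
        using surj[of m "y' m"] y' xS[of m] x(2) by (cases "m < max n N") (auto simp: less_max_iff_disj)
      then obtain y where "\<And>m. y m \<in> S m \<and> p m (y m) = y' m \<and> (m < n \<longrightarrow> y m = x m)"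
        by metis
      then show ?thesis
        using n[of y] by (intro image_eqI[of _ _ y]) auto
    qed
    then show "\<exists>n. \<forall>y. (\<forall>m. y m \<in> S' m) \<and> (\<forall>m<n. y m = x' m) \<longrightarrow> y \<in> (\<lambda>x n. p n (x n)) ` U"
      by blast
  qed
qed

text \<open>Each preimage of a basic open set agrees with an open set off a meager set; discarding
  these countably many meager sets makes all preimages relatively open.\<close>

lemma continuous_on_comeager:
  assumes sc: "second_countable Y"
    and F: "\<And>x. x \<in> topspace X \<Longrightarrow> F x \<in> topspace Y"
    and bp: "\<And>V. openin Y V \<Longrightarrow> baire_property X {x \<in> topspace X. F x \<in> V}"
  obtains C where "comeager_in X C" "continuous_map (subtopology X C) Y F"
proof -
  obtain \<B> where B: "countable \<B>" "\<forall>V \<in> \<B>. openin Y V"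
     "\<forall>U x. openin Y U \<and> x \<in> U \<longrightarrow> (\<exists>V \<in> \<B>. x \<in> V \<and> V \<subseteq> U)"
    using sc unfolding second_countable_def by (elim exE conjE) (rule that)
  have "\<forall>V\<in>\<B>. \<exists>U. openin X U \<and> comeager_in X {x. x \<in> {x \<in> topspace X. F x \<in> V} \<longleftrightarrow> x \<in> U}"
    using bp B(2) unfolding baire_property_def by blast
  then obtain U where U: "\<forall>V\<in>\<B>. openin X (U V) \<and>
      comeager_in X {x. x \<in> {x \<in> topspace X. F x \<in> V} \<longleftrightarrow> x \<in> U V}"
    by (rule bchoice[THEN exE])
  define C where "C = (\<Inter>V\<in>\<B>. {x. x \<in> {x \<in> topspace X. F x \<in> V} \<longleftrightarrow> x \<in> U V})"
  have "comeager_in X C"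
    unfolding C_def using B(1) U by (intro comeager_in_INT) auto
  moreover have "continuous_map (subtopology X C) Y F"
    unfolding continuous_map_def
  proof (intro conjI allI impI)
    fix W assume W: "openin Y W"
    have "{x \<in> topspace (subtopology X C). F x \<in> W} = (\<Union>V\<in>{V \<in> \<B>. V \<subseteq> W}. U V) \<inter> C"
    proof (intro subset_antisym subsetI)
      fix x assume x: "x \<in> {x \<in> topspace (subtopology X C). F x \<in> W}"
      then obtain V where V: "V \<in> \<B>" "F x \<in> V" "V \<subseteq> W"
        using B(3) W by blast
      then have "x \<in> U V"
        using x unfolding C_def by auto
      then show "x \<in> (\<Union>V\<in>{V \<in> \<B>. V \<subseteq> W}. U V) \<inter> C"
        using V x by auto
    next
      fix x assume x: "x \<in> (\<Union>V\<in>{V \<in> \<B>. V \<subseteq> W}. U V) \<inter> C"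
      then obtain V where V: "V \<in> \<B>" "V \<subseteq> W" "x \<in> U V" by blast
      then have "x \<in> topspace X \<and> F x \<in> V"
        using x unfolding C_def by auto
      then show "x \<in> {x \<in> topspace (subtopology X C). F x \<in> W}"
        using V x by auto
    qed
    moreover have "openin X (\<Union>V\<in>{V \<in> \<B>. V \<subseteq> W}. U V)"
      using U by auto
    ultimately show "openin (subtopology X C) {x \<in> topspace (subtopology X C). F x \<in> W}"
      unfolding openin_subtopology by blast
  qed (use F in auto)
  ultimately show ?thesis
    by (rule that)
qed

section \<open>Open cosets\<close>

text \<open>A nonempty set is closed under \<open>a b\<^sup>-\<^sup>1 c\<close> iff it is a coset of a subgroup.\<close>

definition open_coset :: "('a, 'm) monoid_scheme \<Rightarrow> 'a topology \<Rightarrow> 'a set \<Rightarrow> bool" where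
  "open_coset G T W \<longleftrightarrow> openin T W \<and> (\<forall>a\<in>W. \<forall>b\<in>W. \<forall>c\<in>W. a \<otimes>\<^bsub>G\<^esub> inv\<^bsub>G\<^esub> b \<otimes>\<^bsub>G\<^esub> c \<in> W)"

context polish_group
begin

lemma openin_subset_carrier: "openin T U \<Longrightarrow> U \<subseteq> carrier G"
  using openin_subset topspace_eq_carrier by metis

lemma continuous_map_mult:
  assumes "continuous_map X T f" "continuous_map X T g"
  shows "continuous_map X T (\<lambda>x. f x \<otimes> g x)"
proof -
  have "continuous_map X T ((\<lambda>(g, h). g \<otimes> h) \<circ> (\<lambda>x. (f x, g x)))"
    by (rule continuous_map_compose[OF _ continuous_mult])
      (use assms in \<open>simp add: continuous_map_pairedI\<close>)
  then show ?thesis by (simp add: o_def)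
qed

lemma continuous_map_left_mult: "a \<in> carrier G \<Longrightarrow> continuous_map T T (\<lambda>x. a \<otimes> x)"
  by (intro continuous_map_mult) (auto simp: topspace_eq_carrier)

lemma continuous_map_right_mult: "a \<in> carrier G \<Longrightarrow> continuous_map T T (\<lambda>x. x \<otimes> a)"
  by (intro continuous_map_mult) (auto simp: topspace_eq_carrier)

lemma openin_left_mult_vimage:
  assumes "openin T U" "a \<in> carrier G"
  shows "openin T {x \<in> carrier G. a \<otimes> x \<in> U}"
  using openin_continuous_map_preimage[OF continuous_map_left_mult[OF assms(2)] assms(1)]
  by (simp add: topspace_eq_carrier)

lemma open_coset_carrier: "open_coset G T (carrier G)"
  unfolding open_coset_def by (simp flip: topspace_eq_carrier) (simp add: topspace_eq_carrier)

text \<open>Cosets of open subgroups are closed. This keeps limits of elements of \<open>W\<close>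
  inside \<open>W\<close>.\<close>

lemma open_coset_closedin:
  assumes W: "open_coset G T W"
  shows "closedin T W"
proof -
  have "g \<in> W" if g: "g \<in> T closure_of W" for g
  proof -
    have WG: "W \<subseteq> carrier G"
      using W openin_subset_carrier unfolding open_coset_def by blast
    have gG: "g \<in> carrier G"
      using g by (simp add: in_closure_of topspace_eq_carrier)
    have meets: "\<exists>y. y \<in> W \<and> y \<in> V" if "g \<in> V" "openin T V" for V
      using g that unfolding in_closure_of by blast
    obtain h where h: "h \<in> W"
      using meets[OF _ openin_topspace] gG topspace_eq_carrier by blast
    then have hG: "h \<in> carrier G"
      using WG by blast
    \<comment> \<open>Translation by \<open>h \<otimes> inv g\<close> sends \<open>g\<close> to
      \<open>h \<in> W\<close>, so some \<open>u \<in> W\<close> close to \<open>g\<close> is also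
      sent into \<open>W\<close>. The ternary law applied to \<open>u\<close>, its image and
      \<open>h\<close> returns \<open>g\<close>.\<close>
    have "openin T {x \<in> carrier G. h \<otimes> inv g \<otimes> x \<in> W}"
      using W gG hG unfolding open_coset_def by (intro openin_left_mult_vimage) auto
    moreover have "g \<in> {x \<in> carrier G. h \<otimes> inv g \<otimes> x \<in> W}"
      using gG hG h by (simp add: m_assoc)
    ultimately obtain u where u: "u \<in> W" "h \<otimes> inv g \<otimes> u \<in> W"
      using meets[of "{x \<in> carrier G. h \<otimes> inv g \<otimes> x \<in> W}"] by auto
    then have uG: "u \<in> carrier G"
      using WG by blast
    have "u \<otimes> inv (h \<otimes> inv g \<otimes> u) \<otimes> h \<in> W"
      using W u h unfolding open_coset_def by blast
    moreover have "u \<otimes> inv (h \<otimes> inv g \<otimes> u) \<otimes> h = g"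
      using uG hG gG by (simp add: inv_mult_group m_assoc) (simp flip: m_assoc)
    ultimately show ?thesis by simp
  qed
  then show ?thesis
    using W openin_subset unfolding open_coset_def by (metis closure_of_subset_eq subsetI)
qed

lemma open_coset_base:
  assumes "non_archimedean G T" "openin T V" "g \<in> V"
  obtains W where "open_coset G T W" "g \<in> W" "W \<subseteq> V"
proof -
  have g: "g \<in> carrier G"
    using assms openin_subset_carrier by blast
  have g_inv: "g \<otimes> (inv g \<otimes> x) = x" if "x \<in> carrier G" for x
    using g that by (simp flip: m_assoc)
  have "openin T {x \<in> carrier G. g \<otimes> x \<in> V}" "\<one> \<in> {x \<in> carrier G. g \<otimes> x \<in> V}"
    using assms g by (auto intro: openin_left_mult_vimage)
  then obtain K where K: "subgroup K G" "openin T K" "K \<subseteq> {x \<in> carrier G. g \<otimes> x \<in> V}"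
    using assms(1) unfolding non_archimedean_def by metis
  \<comment> \<open>\<open>W\<close> is the left coset \<open>gK\<close>.\<close>
  define W where "W = {x \<in> carrier G. inv g \<otimes> x \<in> K}"
  have "openin T W"
    unfolding W_def using g K by (intro openin_left_mult_vimage) auto
  moreover have "a \<otimes> inv b \<otimes> c \<in> W" if "a \<in> W" "b \<in> W" "c \<in> W" for a b c
  proof -
    have G: "a \<in> carrier G" "b \<in> carrier G" "c \<in> carrier G"
      using that by (auto simp: W_def)
    have "(inv g \<otimes> a) \<otimes> inv (inv g \<otimes> b) \<otimes> (inv g \<otimes> c) \<in> K"
      using that K(1) by (simp add: W_def subgroup.m_closed subgroup.m_inv_closed)
    also have "(inv g \<otimes> a) \<otimes> inv (inv g \<otimes> b) \<otimes> (inv g \<otimes> c) = inv g \<otimes> (a \<otimes> inv b \<otimes> c)"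
      using G g by (simp add: inv_mult_group m_assoc) (simp add: g_inv)
    finally show ?thesis
      using G by (simp add: W_def)
  qed
  moreover have "g \<in> W"
    using g K(1) by (simp add: W_def subgroup.one_closed)
  moreover have "W \<subseteq> V"
  proof
    fix x assume "x \<in> W"
    then have "x \<in> carrier G" "g \<otimes> (inv g \<otimes> x) \<in> V"
      using K(3) by (auto simp: W_def)
    then show "x \<in> V"
      by (simp add: g_inv)
  qed
  ultimately show ?thesis
    using that unfolding open_coset_def by blast
qed

end

section \<open>Orbit equivalence along adjacent sequences\<close>

text \<open>This is \<open>|i - j| \<le> 1\<close> without truncated subtraction.\<close>

definition adjacent :: "nat \<Rightarrow> nat \<Rightarrow> bool" where
  "adjacent i j \<longleftrightarrow> i \<le> Suc j \<and> j \<le> Suc i"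

definition pair_space :: "nat \<Rightarrow> (nat \<Rightarrow> nat \<times> nat) \<Rightarrow> (nat \<Rightarrow> nat \<times> nat) topology" where
  "pair_space n w = seq_space (\<lambda>m. if m < n then {w m} else {(i, j). adjacent i j})"

abbreviation baire_space :: "(nat \<Rightarrow> nat) topology" where
  "baire_space \<equiv> seq_space (\<lambda>_. UNIV)"

section \<open>Pair spaces and their projections\<close>

lemma in_topspace_pair_space:
  "z \<in> topspace (pair_space n w) \<longleftrightarrow>
    (\<forall>m<n. z m = w m) \<and> (\<forall>m\<ge>n. adjacent (fst (z m)) (snd (z m)))"
proof -
  have "z m \<in> {(i, j). adjacent i j} \<longleftrightarrow> adjacent (fst (z m)) (snd (z m))" for m
    by (cases "z m") auto
  then show ?thesis
    unfolding pair_space_def by (auto simp: not_less)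
qed

lemma pair_space_nonempty: "topspace (pair_space n w) \<noteq> {}"
proof -
  have "(\<lambda>m. if m < n then w m else (0, 0)) \<in> topspace (pair_space n w)"
    by (simp add: in_topspace_pair_space adjacent_def)
  then show ?thesis by blast
qed

lemma completely_metrizable_pair_space: "completely_metrizable_space (pair_space n w)"
  by (simp add: pair_space_def completely_metrizable_seq_space)

text \<open>The diagonal pairs \<open>(b, b)\<close> are adjacent, so beyond the stem every value
  occurs as a first component; this makes the projection open.\<close>

lemma pair_space_fst:
  "continuous_map (pair_space n w) baire_space (\<lambda>z m. fst (z m))"
  "open_map (pair_space n w) baire_space (\<lambda>z m. fst (z m))"
proof -
  show "continuous_map (pair_space n w) baire_space (\<lambda>z m. fst (z m))"
    unfolding pair_space_def by (rule coordinatewise_continuous_map) simp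
  have "\<exists>p\<in>(if m < n then {w m} else {(i, j). adjacent i j}). fst p = b" if "n \<le> m" for m b
    using that by (intro bexI[of _ "(b, b)"]) (auto simp: adjacent_def)
  then show "open_map (pair_space n w) baire_space (\<lambda>z m. fst (z m))"
    unfolding pair_space_def by (intro coordinatewise_open_map[where N = n]) auto
qed

lemma pair_space_snd:
  "continuous_map (pair_space n w) baire_space (\<lambda>z m. snd (z m))"
  "open_map (pair_space n w) baire_space (\<lambda>z m. snd (z m))"
proof -
  show "continuous_map (pair_space n w) baire_space (\<lambda>z m. snd (z m))"
    unfolding pair_space_def by (rule coordinatewise_continuous_map) simp
  have "\<exists>p\<in>(if m < n then {w m} else {(i, j). adjacent i j}). snd p = b" if "n \<le> m" for m b
    using that by (intro bexI[of _ "(b, b)"]) (auto simp: adjacent_def)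
  then show "open_map (pair_space n w) baire_space (\<lambda>z m. snd (z m))"
    unfolding pair_space_def by (intro coordinatewise_open_map[where N = n]) auto
qed

text \<open>Prolonging a stem by adjacent pairs gives an open subspace, so generic statements
  persist under such extensions.\<close>

lemma pair_space_inclusion:
  assumes "n \<le> n'" "\<And>m. m < n \<Longrightarrow> w' m = w m"
    and "\<And>m. \<lbrakk>n \<le> m; m < n'\<rbrakk> \<Longrightarrow> adjacent (fst (w' m)) (snd (w' m))"
  shows "continuous_map (pair_space n' w') (pair_space n w) (\<lambda>z m. z m)"
    and "open_map (pair_space n' w') (pair_space n w) (\<lambda>z m. z m)"
proof -
  have sub: "a \<in> (if m < n then {w m} else {(i, j). adjacent i j})"
    if "a \<in> (if m < n' then {w' m} else {(i, j). adjacent i j})" for m a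
  proof (cases "m < n'")
    case True
    then have "a = w' m" using that by simp
    then show ?thesis
      using True assms(2)[of m] assms(3)[of m] by (auto simp: case_prod_unfold)
  next
    case False
    then show ?thesis using that assms(1) by simp
  qed
  show "continuous_map (pair_space n' w') (pair_space n w) (\<lambda>z m. z m)"
    unfolding pair_space_def using sub by (rule coordinatewise_continuous_map)
  show "open_map (pair_space n' w') (pair_space n w) (\<lambda>z m. z m)"
    unfolding pair_space_def using sub
    by (rule coordinatewise_open_map[where N = n']) (use assms in auto)
qed

text \<open>Isolates what the construction uses of a Borel reduction composed with the coding map:
  the forward implication for eventually adjacent sequences, and continuity on a comeager
  set.\<close>

locale orbit_homomorphism = polish_H_space H T Y \<phi>
  for H (structure) and T :: "'h topology" and Y :: "'y topology" and \<phi> +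
  fixes F :: "(nat \<Rightarrow> nat) \<Rightarrow> 'y" and C :: "(nat \<Rightarrow> nat) set"
  assumes non_archimedean: "non_archimedean H T"
    and F_closed: "F x \<in> topspace Y"
    and F_adjacent: "\<lbrakk>\<And>m. n \<le> m \<Longrightarrow> adjacent (x m) (y m)\<rbrakk> \<Longrightarrow> \<exists>g\<in>carrier H. F y = \<phi> g (F x)"
    and C_comeager: "comeager_in baire_space C"
    and F_continuous: "continuous_map (subtopology baire_space C) Y F"
begin

section \<open>Pairs moved by a set of group elements: limits and the Baire property\<close>

definition moved_by :: "'h set \<Rightarrow> (nat \<Rightarrow> nat \<times> nat) set" where
  "moved_by W = {z. \<exists>g\<in>W. F (\<lambda>m. snd (z m)) = \<phi> g (F (\<lambda>m. fst (z m)))}"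

lemma limitin_F:
  assumes "\<And>i. z i \<in> C" "x \<in> C" "\<And>i n. n < i \<Longrightarrow> z i n = x n"
  shows "limitin Y (\<lambda>i. F (z i)) (F x) sequentially"
proof -
  have "limitin (subtopology baire_space C) z x sequentially"
    using assms by (auto simp: limitin_subtopology intro: limitin_seq_space)
  from continuous_map_limit[OF F_continuous this] show ?thesis
    by (simp add: o_def)
qed

lemma action_limit:
  assumes g: "limitin T g l sequentially" and u: "limitin Y u a sequentially"
    and v: "limitin Y v b sequentially" and eq: "\<And>n. v n = \<phi> (g n) (u n)"
  shows "b = \<phi> l a"
proof -
  have "limitin (prod_topology T Y) (\<lambda>n. (g n, u n)) (l, a) sequentially"
    using g u by (simp add: limitin_pairwise o_def)
  from continuous_map_limit[OF continuous_action this]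
  have "limitin Y v (\<phi> l a) sequentially"
    by (simp add: o_def flip: eq)
  then show ?thesis
    using v polish_topology_Hausdorff[OF polish_space]
    by (intro limitin_Hausdorff_unique[of Y v b _ "\<phi> l a"]) auto
qed

text \<open>A closedness property of the relation \<open>F y = \<phi> g (F x)\<close>. As
  \<open>F\<close> is continuous only on \<open>C\<close>, both the approximating pairs and the
  limit pair must lie over \<open>C\<close>.\<close>

lemma moved_by_limit:
  assumes g: "limitin T g l sequentially" "\<And>i. F (\<lambda>m. snd (z i m)) = \<phi> (g i) (F (\<lambda>m. fst (z i m)))"
    and z: "\<And>i. (\<lambda>m. fst (z i m)) \<in> C" "\<And>i. (\<lambda>m. snd (z i m)) \<in> C"
    and x: "(\<lambda>m. fst (x m)) \<in> C" "(\<lambda>m. snd (x m)) \<in> C"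
    and zx: "\<And>i m. m < i \<Longrightarrow> z i m = x m"
  shows "F (\<lambda>m. snd (x m)) = \<phi> l (F (\<lambda>m. fst (x m)))"
  using g(1) limitin_F[OF z(1) x(1)] limitin_F[OF z(2) x(2)] g(2)
  by (rule action_limit) (simp_all add: zx)

lemma comeager_pairs_in_C:
  "comeager_in (pair_space n w) {z. (\<lambda>m. fst (z m)) \<in> C \<and> (\<lambda>m. snd (z m)) \<in> C}"
  using comeager_in_Int[OF comeager_in_vimage[OF pair_space_fst C_comeager]
      comeager_in_vimage[OF pair_space_snd C_comeager]]
  by (rule comeager_in_mono) auto

text \<open>Over \<open>C\<close>, the set \<open>moved_by W\<close> is the projection along
  \<open>W\<close> of a relatively closed relation. The Souslin scheme locates the moving element in
  successive covers of the group.\<close>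

lemma baire_property_moved_by:
  assumes W: "open_coset H T W"
  shows "baire_property (pair_space n w) (moved_by W)"
proof -
  obtain B :: "nat \<Rightarrow> nat \<Rightarrow> 'h set" where B_cover: "\<And>k. topspace T \<subseteq> (\<Union>i. B k i)"
    and B_lim: "\<forall>b g. (\<forall>k n. k \<le> n \<longrightarrow> g n \<in> B k (b k)) \<longrightarrow> (\<exists>l. limitin T g l sequentially)"
    by (rule polish_topology_covers[OF polish]) (rule that)
  have WT: "W \<subseteq> topspace T"
    using W openin_subset unfolding open_coset_def by blast
  define M where "M = {z. (\<lambda>m. fst (z m)) \<in> C \<and> (\<lambda>m. snd (z m)) \<in> C}"
  define A where "A s = M \<inter> moved_by {g \<in> W. \<forall>k<length s. g \<in> B k (s ! k)}" for s
  have "baire_property (pair_space n w) (A [])"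
  proof (rule baire_property_souslin_scheme)
    show "second_countable (pair_space n w)"
      unfolding pair_space_def by (rule second_countable_seq_space)
    show "comeager_in (pair_space n w) M"
      unfolding M_def by (rule comeager_pairs_in_C)
    show "A s \<subseteq> (\<Union>i. A (s @ [i]))" for s
    proof
      fix z assume "z \<in> A s"
      then obtain g where g: "z \<in> M" "g \<in> W" "\<And>k. k < length s \<Longrightarrow> g \<in> B k (s ! k)"
        "F (\<lambda>m. snd (z m)) = \<phi> g (F (\<lambda>m. fst (z m)))"
        by (auto simp: A_def moved_by_def)
      obtain i where "g \<in> B (length s) i"
        using B_cover WT g(2) by blast
      then have "g \<in> B k ((s @ [i]) ! k)" if "k < length (s @ [i])" for k
        using g(3)[of k] that by (cases "k < length s") (auto simp: nth_append less_Suc_eq)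
      then show "z \<in> (\<Union>i. A (s @ [i]))"
        using g by (auto simp: A_def moved_by_def)
    qed
    fix b x
    assume x: "x \<in> M" and cl: "\<And>k. x \<in> pair_space n w closure_of A (map b [0..<k])"
    \<comment> \<open>Approximations agreeing with \<open>x\<close> below \<open>i\<close> have
      movers in the chosen members of the covers \<open>0\<close> to \<open>i\<close>. These movers
      converge, and the limit stays in the closed set \<open>W\<close>.\<close>
    have "\<exists>z g. z \<in> M \<and> (\<forall>m<i. z m = x m) \<and> g \<in> W \<and> (\<forall>k\<le>i. g \<in> B k (b k)) \<and>
        F (\<lambda>m. snd (z m)) = \<phi> g (F (\<lambda>m. fst (z m)))" for i
    proof -
      obtain z where z: "z \<in> A (map b [0..<Suc i])" "\<forall>m<i. z m = x m"
        using cl[of "Suc i"] unfolding pair_space_def by (rule closure_of_seq_space)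
      then obtain g where g: "z \<in> M" "g \<in> W" "\<forall>k<Suc i. g \<in> B k (map b [0..<Suc i] ! k)"
        "F (\<lambda>m. snd (z m)) = \<phi> g (F (\<lambda>m. fst (z m)))"
        by (auto simp: A_def moved_by_def)
      moreover have "g \<in> B k (b k)" if "k \<le> i" for k
      proof -
        have "g \<in> B k (map b [0..<Suc i] ! k)" using g(3) that by simp
        then show ?thesis using that by (simp del: upt_Suc)
      qed
      ultimately show ?thesis
        using z(2) by blast
    qed
    then obtain z g where zg: "\<And>i. z i \<in> M" "\<And>i m. m < i \<Longrightarrow> z i m = x m" "\<And>i. g i \<in> W"
      "\<And>i k. k \<le> i \<Longrightarrow> g i \<in> B k (b k)" "\<And>i. F (\<lambda>m. snd (z i m)) = \<phi> (g i) (F (\<lambda>m. fst (z i m)))"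
      by metis
    obtain l where l: "limitin T g l sequentially"
      using B_lim zg(4) by blast
    have "l \<in> W"
      by (rule limitin_closedin[OF l open_coset_closedin[OF W]]) (use zg(3) in auto)
    moreover have "F (\<lambda>m. snd (x m)) = \<phi> l (F (\<lambda>m. fst (x m)))"
      using l zg(5) by (rule moved_by_limit) (use zg x in \<open>auto simp: M_def\<close>)
    ultimately show "x \<in> A []"
      using x by (auto simp: A_def moved_by_def)
  qed
  \<comment> \<open>\<open>A []\<close> is \<open>moved_by W\<close> restricted to the comeager set
    \<open>M\<close>.\<close>
  then show ?thesis
    by (rule baire_property_cong)
      (rule comeager_in_mono[OF comeager_pairs_in_C], auto simp: A_def M_def)
qed

section \<open>Composing small steps along zigzags\<close>

lemma moved_by_compose:
  assumes W: "open_coset H T W"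
    and R: "(\<lambda>m. (a' m, b m)) \<in> moved_by W" "(\<lambda>m. (a' m, b' m)) \<in> moved_by W"
      "(\<lambda>m. (a m, b' m)) \<in> moved_by W"
  shows "(\<lambda>m. (a m, b m)) \<in> moved_by W"
proof -
  obtain g1 g2 g3 where g: "g1 \<in> W" "g2 \<in> W" "g3 \<in> W"
    and F: "F b = \<phi> g1 (F a')" "F b' = \<phi> g2 (F a')" "F b' = \<phi> g3 (F a)"
    using R by (auto simp: moved_by_def)
  have G: "g1 \<in> carrier H" "g2 \<in> carrier H" "g3 \<in> carrier H"
    using g W openin_subset_carrier unfolding open_coset_def by blast+
  \<comment> \<open>Travelling \<open>a\<close>, \<open>b'\<close>, \<open>a'\<close>,
    \<open>b\<close> uses the middle edge backwards, which produces the ternary product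
    \<open>g1 \<otimes> inv g2 \<otimes> g3\<close>.\<close>
  have "\<phi> (inv g2) (F b') = F a'"
    by (rule orbit_sym_aux) (use G F F_closed in auto)
  then have "F b = \<phi> g1 (\<phi> (inv g2) (\<phi> g3 (F a)))"
    using F by simp
  also have "\<dots> = \<phi> (g1 \<otimes> inv g2 \<otimes> g3) (F a)"
    using G F_closed[of a] element_image[OF G(3) F_closed refl, of a]
    by (simp add: composition_rule)
  finally show ?thesis
    using W g unfolding open_coset_def moved_by_def by auto
qed

text \<open>A generic pair \<open>(x, y)\<close> above \<open>(a, b)\<close> is completed to a zigzag
  \<open>x - y' - x' - y\<close> of adjacent sequences whose other three edges are generic above
  \<open>(a, b')\<close>, \<open>(a', b')\<close> and \<open>(a', b)\<close>.\<close>

lemma comeager_moved_by_zigzag: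
  assumes W: "open_coset H T W"
    and R: "comeager_in (pair_space n (\<lambda>m. (a' m, b m))) (moved_by W)"
      "comeager_in (pair_space n (\<lambda>m. (a' m, b' m))) (moved_by W)"
      "comeager_in (pair_space n (\<lambda>m. (a m, b' m))) (moved_by W)"
  shows "comeager_in (pair_space n (\<lambda>m. (a m, b m))) (moved_by W)"
proof (rule ccontr)
  let ?P = "pair_space n (\<lambda>m. (a m, b m))"
  assume contr: "\<not> comeager_in ?P (moved_by W)"
  \<comment> \<open>Were the claim false, the Baire property would give a nonempty open
    \<open>U\<close> in which generic pairs are not moved by \<open>W\<close>.\<close>
  have "\<not> comeager_in ?P {z. z \<notin> topspace ?P - moved_by W}"
  proof
    assume "comeager_in ?P {z. z \<notin> topspace ?P - moved_by W}"
    then have "comeager_in ?P (moved_by W)"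
      by (rule comeager_in_mono) auto
    then show False using contr by simp
  qed
  then obtain U where U: "openin ?P U" "U \<noteq> {}"
      "comeager_in ?P {z. z \<in> U \<longrightarrow> z \<in> topspace ?P - moved_by W}"
    by (rule baire_property_nonmeager[OF baire_property_compl[OF baire_property_moved_by[OF W]]])
  \<comment> \<open>A coordinate \<open>((i, j), (i', j'))\<close> carries the entries of
    \<open>x, y\<close> and \<open>x', y'\<close>; the four conditions are the three edges of the
    zigzag and the closing edge \<open>x - y\<close>.\<close>
  define S where "S m = (if m < n then {((a m, b m), (a' m, b' m))}
    else {((i, j), (i', j')) | i j i' j'. adjacent i j \<and> adjacent i' j \<and> adjacent i' j' \<and> adjacent i j'})" for m
  let ?Q = "seq_space S"
  \<comment> \<open>A degenerate quadruple \<open>((i, j), (i, j))\<close> lies over each adjacent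
    pair, so all four projections are open.\<close>
  have proj: "continuous_map ?Q (pair_space n w) (\<lambda>q m. p (q m))"
      "open_map ?Q (pair_space n w) (\<lambda>q m. p (q m))"
    if p: "\<And>m q. q \<in> S m \<Longrightarrow> p q \<in> (if m < n then {w m} else {(i, j). adjacent i j})"
      "\<And>i j. adjacent i j \<Longrightarrow> p ((i, j), (i, j)) = (i, j)" for p w
  proof -
    show "continuous_map ?Q (pair_space n w) (\<lambda>q m. p (q m))"
      unfolding pair_space_def using p(1) by (rule coordinatewise_continuous_map)
    have "\<exists>q\<in>S m. p q = e" if "n \<le> m" "e \<in> {(i, j). adjacent i j}" for m e
    proof -
      obtain i j where e: "e = (i, j)" by (cases e)
      then have "((i, j), (i, j)) \<in> S m" "p ((i, j), (i, j)) = e"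
        using that p(2) by (auto simp: S_def)
      then show ?thesis by blast
    qed
    then show "open_map ?Q (pair_space n w) (\<lambda>q m. p (q m))"
      unfolding pair_space_def using p(1) by (intro coordinatewise_open_map[where N = n]) auto
  qed
  have proj1: "continuous_map ?Q ?P (\<lambda>q m. fst (q m))" "open_map ?Q ?P (\<lambda>q m. fst (q m))"
    by (intro proj[where p = fst]; auto simp: S_def split: if_splits)+
  have proj2: "continuous_map ?Q (pair_space n (\<lambda>m. (a' m, b m))) (\<lambda>q m. (fst (snd (q m)), snd (fst (q m))))"
    "open_map ?Q (pair_space n (\<lambda>m. (a' m, b m))) (\<lambda>q m. (fst (snd (q m)), snd (fst (q m))))"
    by (intro proj[where p = "\<lambda>q. (fst (snd q), snd (fst q))"]; auto simp: S_def split: if_splits)+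
  have proj3: "continuous_map ?Q (pair_space n (\<lambda>m. (a' m, b' m))) (\<lambda>q m. snd (q m))"
    "open_map ?Q (pair_space n (\<lambda>m. (a' m, b' m))) (\<lambda>q m. snd (q m))"
    by (intro proj[where p = snd]; auto simp: S_def split: if_splits)+
  have proj4: "continuous_map ?Q (pair_space n (\<lambda>m. (a m, b' m))) (\<lambda>q m. (fst (fst (q m)), snd (snd (q m))))"
    "open_map ?Q (pair_space n (\<lambda>m. (a m, b' m))) (\<lambda>q m. (fst (fst (q m)), snd (snd (q m))))"
    by (intro proj[where p = "\<lambda>q. (fst (fst q), snd (snd q))"]; auto simp: S_def split: if_splits)+
  \<comment> \<open>For a generic quadruple the three zigzag edges are moved by \<open>W\<close>,
    hence so is the closing edge, which therefore cannot fall into \<open>U\<close>.\<close>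
  have "comeager_in ?Q {q. (\<lambda>m. fst (q m)) \<notin> U}"
  proof (rule comeager_in_mono)
    show "comeager_in ?Q ({q. (\<lambda>m. fst (q m)) \<in> {z. z \<in> U \<longrightarrow> z \<in> topspace ?P - moved_by W}} \<inter>
        ({q. (\<lambda>m. (fst (snd (q m)), snd (fst (q m)))) \<in> moved_by W} \<inter>
        ({q. (\<lambda>m. snd (q m)) \<in> moved_by W} \<inter> {q. (\<lambda>m. (fst (fst (q m)), snd (snd (q m)))) \<in> moved_by W})))"
      by (intro comeager_in_Int comeager_in_vimage[OF proj1 U(3)] comeager_in_vimage[OF proj2 R(1)]
          comeager_in_vimage[OF proj3 R(2)] comeager_in_vimage[OF proj4 R(3)])
    fix q
    assume q: "q \<in> {q. (\<lambda>m. fst (q m)) \<in> {z. z \<in> U \<longrightarrow> z \<in> topspace ?P - moved_by W}} \<inter>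
        ({q. (\<lambda>m. (fst (snd (q m)), snd (fst (q m)))) \<in> moved_by W} \<inter>
        ({q. (\<lambda>m. snd (q m)) \<in> moved_by W} \<inter> {q. (\<lambda>m. (fst (fst (q m)), snd (snd (q m)))) \<in> moved_by W}))"
    have "(\<lambda>m. (fst (fst (q m)), snd (fst (q m)))) \<in> moved_by W"
      by (rule moved_by_compose[OF W, of "\<lambda>m. fst (snd (q m))" _ "\<lambda>m. snd (snd (q m))"]) (use q in auto)
    then show "q \<in> {q. (\<lambda>m. fst (q m)) \<notin> U}"
      using q by auto
  qed
  moreover have "openin ?Q {q \<in> topspace ?Q. (\<lambda>m. fst (q m)) \<in> U}"
    using proj1(1) U(1) by (rule openin_continuous_map_preimage)
  moreover have "{q \<in> topspace ?Q. (\<lambda>m. fst (q m)) \<in> U} \<noteq> {}"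
  proof -
    obtain z where z: "z \<in> U" using U(2) by blast
    then have zP: "z \<in> topspace ?P" using openin_subset[OF U(1)] by blast
    \<comment> \<open>Above a pair in \<open>U\<close>, the quadruple is taken degenerate beyond the
      stem.\<close>
    define q where "q m = (z m, if m < n then (a' m, b' m) else z m)" for m
    have "q m \<in> S m" for m
      using zP by (cases "z m") (auto simp: in_topspace_pair_space q_def S_def not_less)
    moreover have "(\<lambda>m. fst (q m)) = z"
      by (simp add: q_def)
    ultimately have "q \<in> {q \<in> topspace ?Q. (\<lambda>m. fst (q m)) \<in> U}"
      using z by simp
    then show ?thesis by blast
  qed
  ultimately show False
    using comeager_in_meets_open[OF completely_metrizable_seq_space[of S]] by blast
qed

text \<open>Adjacent new entries only restrict to an open subspace. The pair
  \<open>(Suc k, 0)\<close> is reached by the zigzag through \<open>(Suc k, k)\<close>,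
  \<open>(k, k)\<close> and \<open>(k, 0)\<close>, the last by induction.\<close>

lemma comeager_moved_by_extend:
  assumes W: "open_coset H T W" and good: "comeager_in (pair_space n w) (moved_by W)"
  shows "comeager_in (pair_space (Suc n) (w(n := (k, 0)))) (moved_by W)"
proof -
  define a where "a i = (\<lambda>m. fst (w m))(n := i)" for i
  define b where "b i = (\<lambda>m. snd (w m))(n := i)" for i
  have ab: "(\<lambda>m. (a i m, b j m)) = w(n := (i, j))" for i j
    by (auto simp: a_def b_def)
  have adj: "comeager_in (pair_space (Suc n) (\<lambda>m. (a i m, b j m))) (moved_by W)" if "adjacent i j" for i j
    unfolding ab using comeager_in_vimage[OF pair_space_inclusion good, of "Suc n" "w(n := (i, j))"] that
    by auto
  have "comeager_in (pair_space (Suc n) (\<lambda>m. (a k m, b 0 m))) (moved_by W)"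
  proof (induction k)
    case 0
    show ?case by (rule adj) (simp add: adjacent_def)
  next
    case (Suc k)
    show ?case
      by (rule comeager_moved_by_zigzag[OF W Suc adj[of k k] adj[of "Suc k" k]]) (auto simp: adjacent_def)
  qed
  then show ?thesis by (simp add: ab)
qed

text \<open>\<open>W\<close> is covered by countably many open cosets, each inside some
  \<open>B i\<close>. One of them moves a nonmeager set of pairs, hence generic pairs above some
  longer stem, which is lengthened further to enter the dense open \<open>U\<close>.\<close>

lemma comeager_moved_by_refine:
  assumes W: "open_coset H T W" and good: "comeager_in (pair_space n w) (moved_by W)"
    and U: "openin baire_space U" "baire_space closure_of U = topspace baire_space"
    and B: "\<And>i. openin T (B i)" "topspace T \<subseteq> (\<Union>i. B i)"
  obtains n' w' W' i where "n \<le> n'" "\<forall>m<n. w' m = w m"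
    "open_coset H T W'" "comeager_in (pair_space n' w') (moved_by W')" "W' \<subseteq> W" "W' \<subseteq> B i"
    "\<forall>z. (\<forall>m<n'. z m = w' m) \<longrightarrow> (\<lambda>m. fst (z m)) \<in> U \<and> (\<lambda>m. snd (z m)) \<in> U"
proof -
  let ?P = "pair_space n w"
  define \<V> where "\<V> = {V. open_coset H T V \<and> V \<subseteq> W \<and> (\<exists>i. V \<subseteq> B i)}"
  have WT: "openin T W" "W \<subseteq> topspace T"
    using W openin_subset unfolding open_coset_def by blast+
  have "\<Union>\<V> = topspace (subtopology T W)"
  proof (intro subset_antisym subsetI)
    show "g \<in> topspace (subtopology T W)" if "g \<in> \<Union>\<V>" for g
      using that WT unfolding \<V>_def by auto
    fix g assume "g \<in> topspace (subtopology T W)"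
    then have g: "g \<in> W" by simp
    then obtain i where i: "g \<in> B i" using B(2) WT(2) by blast
    have "openin T (W \<inter> B i)" "g \<in> W \<inter> B i"
      using WT B(1) g i by auto
    then obtain V where "open_coset H T V" "g \<in> V" "V \<subseteq> W \<inter> B i"
      by (rule open_coset_base[OF non_archimedean])
    then show "g \<in> \<Union>\<V>" unfolding \<V>_def by blast
  qed
  moreover have "openin (subtopology T W) V" if "V \<in> \<V>" for V
    using that WT(1) unfolding \<V>_def open_coset_def by (simp add: openin_open_subtopology)
  moreover have "Lindelof_space (subtopology T W)"
    using polish_topology_second_countable[OF polish]
    by (intro second_countable_imp_Lindelof_space second_countable_subtopology)
  ultimately obtain \<C> where \<C>: "countable \<C>" "\<C> \<subseteq> \<V>" "\<Union>\<C> = topspace (subtopology T W)"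
    using Lindelof_spaceD by metis
  \<comment> \<open>Otherwise countably many meager sets would cover the comeager set
    \<open>moved_by W\<close> in a nonempty Baire space.\<close>
  have "\<exists>V\<in>\<C>. \<not> comeager_in ?P {z. z \<notin> moved_by V}"
  proof (rule ccontr)
    assume "\<not> ?thesis"
    then have "comeager_in ?P (\<Inter>V\<in>\<C>. {z. z \<notin> moved_by V})"
      using \<C>(1) by (intro comeager_in_INT) auto
    from comeager_in_Int[OF good this] have "comeager_in ?P {}"
    proof (rule comeager_in_mono)
      fix z assume z: "z \<in> moved_by W \<inter> (\<Inter>V\<in>\<C>. {z. z \<notin> moved_by V})"
      then obtain g where g: "g \<in> W" "F (\<lambda>m. snd (z m)) = \<phi> g (F (\<lambda>m. fst (z m)))"
        by (auto simp: moved_by_def)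
      then have "g \<in> \<Union>\<C>" using \<C>(3) WT(2) by auto
      then obtain V where "V \<in> \<C>" "g \<in> V" by blast
      then show "z \<in> {}" using g z by (auto simp: moved_by_def)
    qed
    then show False
      using comeager_in_meets_open[OF completely_metrizable_pair_space _ openin_topspace pair_space_nonempty]
      by blast
  qed
  then obtain V where V: "V \<in> \<C>" "\<not> comeager_in ?P {z. z \<notin> moved_by V}" by blast
  then have "V \<in> \<V>" using \<C>(2) by blast
  then obtain i where i: "open_coset H T V" "V \<subseteq> W" "V \<subseteq> B i"
    unfolding \<V>_def by blast
  obtain O1 where O1: "openin ?P O1" "O1 \<noteq> {}" "comeager_in ?P {z. z \<in> O1 \<longrightarrow> z \<in> moved_by V}"
    by (rule baire_property_nonmeager[OF baire_property_moved_by[OF i(1)] V(2)])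
  define O2 where "O2 = O1 \<inter> ({z \<in> topspace ?P. (\<lambda>m. fst (z m)) \<in> U} \<inter> {z \<in> topspace ?P. (\<lambda>m. snd (z m)) \<in> U})"
  note fst_U = dense_open_vimage[OF pair_space_fst U, of n w]
  note snd_U = dense_open_vimage[OF pair_space_snd U, of n w]
  have "O1 \<inter> ({z \<in> topspace ?P. (\<lambda>m. fst (z m)) \<in> U} \<inter> {z \<in> topspace ?P. (\<lambda>m. snd (z m)) \<in> U}) \<noteq> {}"
    by (intro comeager_in_meets_open[OF completely_metrizable_pair_space _ O1(1,2)] comeager_in_Int
        comeager_in_dense_open fst_U snd_U)
  then obtain z where z: "z \<in> O2"
    unfolding O2_def by blast
  have O2: "openin ?P O2"
    unfolding O2_def using O1(1) fst_U(1) snd_U(1) by (intro openin_Int)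
  obtain n1 where n1: "\<And>y. y \<in> topspace ?P \<Longrightarrow> (\<forall>m<n1. y m = z m) \<Longrightarrow> y \<in> O2"
    using openin_seq_space_cylinder_subset[OF O2[unfolded pair_space_def] z]
    unfolding pair_space_def by blast
  have zP: "z \<in> topspace ?P"
    using O2 z openin_subset by blast
  have zU: "(\<lambda>m. fst (z m)) \<in> U" "(\<lambda>m. snd (z m)) \<in> U"
    using z by (auto simp: O2_def)
  \<comment> \<open>The bounds \<open>n2\<close> and \<open>n3\<close> force membership in
    \<open>U\<close> for every continuation, not only adjacent ones, since the stems later receive
    entries that are far apart.\<close>
  obtain n2 where n2: "\<And>x. (\<forall>m<n2. x m = fst (z m)) \<Longrightarrow> x \<in> U"
    using openin_seq_space_cylinder_subset[OF U(1) zU(1)]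
    unfolding Ball_def in_topspace_seq_space by blast
  obtain n3 where n3: "\<And>x. (\<forall>m<n3. x m = snd (z m)) \<Longrightarrow> x \<in> U"
    using openin_seq_space_cylinder_subset[OF U(1) zU(2)]
    unfolding Ball_def in_topspace_seq_space by blast
  define n' where "n' = max (max n n1) (max n2 n3)"
  show ?thesis
  proof
    show "n \<le> n'" by (simp add: n'_def)
    show zw: "\<forall>m<n. z m = w m"
      using zP by (simp add: in_topspace_pair_space)
    show "open_coset H T V" "V \<subseteq> W" "V \<subseteq> B i"
      by (fact i)+
    have "continuous_map (pair_space n' z) ?P (\<lambda>z m. z m)" "open_map (pair_space n' z) ?P (\<lambda>z m. z m)"
      using zP by (auto intro!: pair_space_inclusion simp: in_topspace_pair_space n'_def)
    from comeager_in_vimage[OF this O1(3)]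
    show "comeager_in (pair_space n' z) (moved_by V)"
    proof (rule comeager_in_mono)
      fix y assume y: "y \<in> topspace (pair_space n' z)" "y \<in> {x. (\<lambda>m. x m) \<in> {z. z \<in> O1 \<longrightarrow> z \<in> moved_by V}}"
      have "adjacent (fst (y m)) (snd (y m))" if "n \<le> m" for m
        using y(1) zP that by (cases "m < n'") (auto simp: in_topspace_pair_space)
      then have "y \<in> topspace ?P"
        using y(1) zw by (auto simp: in_topspace_pair_space n'_def)
      then have "y \<in> O2"
        using y(1) by (intro n1) (auto simp: in_topspace_pair_space n'_def)
      then show "y \<in> moved_by V"
        using y(2) by (auto simp: O2_def)
    qed
    show "\<forall>y. (\<forall>m<n'. y m = z m) \<longrightarrow> (\<lambda>m. fst (y m)) \<in> U \<and> (\<lambda>m. snd (y m)) \<in> U"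
      using n2 n3 by (simp add: n'_def)
  qed
qed

text \<open>A fusion argument: the stems receive infinitely many entries \<open>(k n, 0)\<close>,
  while the cosets shrink along the covers so that elements chosen from them converge.\<close>

lemma orbit_equivalent_far_apart:
  fixes k :: "nat \<Rightarrow> nat"
  obtains x y g where "g \<in> carrier H" "F y = \<phi> g (F x)" "infinite {n. x n = k n \<and> y n = 0}"
proof -
  obtain \<G> where \<G>: "countable \<G>"
      "\<forall>U\<in>\<G>. openin baire_space U \<and> baire_space closure_of U = topspace baire_space"
      "topspace baire_space \<inter> \<Inter>\<G> \<subseteq> C"
    by (rule comeager_inE[OF C_comeager])
  \<comment> \<open>The whole space is inserted so that the enumerated family is nonempty.\<close>
  define U where "U = from_nat_into (insert (topspace baire_space) \<G>)"
  have range_U: "range U = insert (topspace baire_space) \<G>"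
    unfolding U_def using \<G>(1) by (intro range_from_nat_into) auto
  have U: "openin baire_space (U i)" "baire_space closure_of (U i) = topspace baire_space" for i
    using \<G>(2) range_U rangeI[of U i] by auto
  have U_C: "x \<in> C" if "\<And>i. x \<in> U i" for x
  proof -
    have "x \<in> \<Inter>(range U)" using that by blast
    then show ?thesis using \<G>(3) unfolding range_U by blast
  qed
  obtain B :: "nat \<Rightarrow> nat \<Rightarrow> 'h set" where B_open: "\<And>k i. openin T (B k i)"
    and B_cover: "\<And>k. topspace T \<subseteq> (\<Union>i. B k i)"
    and B_lim: "\<forall>b g. (\<forall>k n. k \<le> n \<longrightarrow> g n \<in> B k (b k)) \<longrightarrow> (\<exists>l. limitin T g l sequentially)"
    by (rule polish_topology_covers[OF polish]) (rule that)
  \<comment> \<open>A stage is a stem length, a stem and an open coset. The clauses of a refinement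
    serve the infinitely many entries \<open>(k n, 0)\<close>, the convergence of the movers, and
    membership of the limit sequences in \<open>C\<close>.\<close>
  define good where "good = (\<lambda>(n, w, W). open_coset H T W \<and> comeager_in (pair_space n w) (moved_by W))"
  define refines where "refines i = (\<lambda>(n, w, W) (n', w', W'). n < n' \<and> (\<forall>m<n. w' m = w m) \<and>
      w' n = (k n, 0) \<and> W' \<subseteq> W \<and> (\<exists>j. W' \<subseteq> B i j) \<and>
      (\<forall>z. (\<forall>m<n'. z m = w' m) \<longrightarrow> (\<lambda>m. fst (z m)) \<in> U i \<and> (\<lambda>m. snd (z m)) \<in> U i))" for i
  have "\<exists>s. \<forall>i. good (s i) \<and> refines i (s i) (s (Suc i))"
  proof (rule dependent_nat_choice)
    \<comment> \<open>The recursion starts with the empty stem: adjacent sequences have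
      orbit-equivalent images, so the whole group moves them.\<close>
    have "comeager_in (pair_space 0 (\<lambda>_. (0, 0))) (moved_by (carrier H))"
    proof (rule comeager_in_topspace, rule subsetI)
      fix z assume "z \<in> topspace (pair_space 0 (\<lambda>_. (0, 0)))"
      then show "z \<in> moved_by (carrier H)"
        using F_adjacent[of 0 "\<lambda>m. fst (z m)" "\<lambda>m. snd (z m)"]
        by (simp add: in_topspace_pair_space moved_by_def)
    qed
    then show "\<exists>s. good s"
      using open_coset_carrier unfolding good_def
      by (intro exI[of _ "(0, \<lambda>_. (0, 0), carrier H)"]) simp
  next
    fix s i assume s: "good s"
    obtain n w W where nwW: "s = (n, w, W)" by (cases s)
    have W: "open_coset H T W" and "comeager_in (pair_space n w) (moved_by W)"
      using s by (auto simp: good_def nwW)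
    then have "comeager_in (pair_space (Suc n) (w(n := (k n, 0)))) (moved_by W)"
      by (rule comeager_moved_by_extend)
    then obtain n' w' W' j where "Suc n \<le> n'" "\<forall>m<Suc n. w' m = (w(n := (k n, 0))) m"
      "open_coset H T W'" "comeager_in (pair_space n' w') (moved_by W')" "W' \<subseteq> W" "W' \<subseteq> B i j"
      "\<forall>z. (\<forall>m<n'. z m = w' m) \<longrightarrow> (\<lambda>m. fst (z m)) \<in> U i \<and> (\<lambda>m. snd (z m)) \<in> U i"
      by (rule comeager_moved_by_refine[OF W _ U[of i] B_open[of i] B_cover[of i]])
    then have "good (n', w', W') \<and> refines i s (n', w', W')"
      unfolding good_def refines_def nwW by auto
    then show "\<exists>s'. good s' \<and> refines i s s'" by blast
  qed
  then obtain s where s: "\<And>i. good (s i)" "\<And>i. refines i (s i) (s (Suc i))" by blast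
  define N where "N i = fst (s i)" for i
  define w where "w i = fst (snd (s i))" for i
  define W where "W i = snd (snd (s i))" for i
  have s_eq: "s i = (N i, w i, W i)" for i
    by (simp add: N_def w_def W_def)
  have good: "comeager_in (pair_space (N i) (w i)) (moved_by (W i))" for i
    using s(1)[of i] by (simp add: good_def s_eq)
  have N_less: "N i < N (Suc i)" and w_Suc: "\<And>m. m < N i \<Longrightarrow> w (Suc i) m = w i m"
    and w_new: "w (Suc i) (N i) = (k (N i), 0)" and W_Suc: "W (Suc i) \<subseteq> W i"
    and W_B: "\<exists>j. W (Suc i) \<subseteq> B i j"
    and w_U: "\<And>z. (\<forall>m<N (Suc i). z m = w (Suc i) m) \<Longrightarrow>
       (\<lambda>m. fst (z m)) \<in> U i \<and> (\<lambda>m. snd (z m)) \<in> U i" for i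
    using s(2)[of i] unfolding refines_def s_eq by auto
  have "strict_mono N"
    using N_less by (rule strict_monoI_Suc)
  then have N_ge: "i \<le> N i" for i
    by (rule strict_mono_imp_increasing)
  have W_anti: "W j \<subseteq> W i" if "i \<le> j" for i j
    using W_Suc that by (rule lift_Suc_antimono_le)
  have w_stable: "w j m = w i m" if "i \<le> j" "m < N i" for i j m
    using that
  proof (induction j rule: dec_induct)
    case (step j)
    then have "m < N j"
      using \<open>strict_mono N\<close> by (meson order_less_le_trans strict_mono_less_eq)
    then show ?case using w_Suc step by simp
  qed simp
  \<comment> \<open>The limit pair is the union of the stems; \<open>m < N (Suc m)\<close> makes
    stage \<open>Suc m\<close> long enough to define entry \<open>m\<close>.\<close>
  define x where "x m = w (Suc m) m" for m
  have x_eq: "x m = w i m" if "m < N i" for m i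
  proof -
    have "m < N (Suc m)" using N_ge[of "Suc m"] by simp
    then show ?thesis
      using w_stable[of "Suc m" "max i (Suc m)" m] w_stable[of i "max i (Suc m)" m] that
      by (simp add: x_def)
  qed
  have x_C: "(\<lambda>m. fst (x m)) \<in> C" "(\<lambda>m. snd (x m)) \<in> C"
    using w_U x_eq by (blast intro!: U_C)+
  obtain b where b: "\<And>i. W (Suc i) \<subseteq> B i (b i)"
    using W_B by metis
  \<comment> \<open>The limit pair need not lie in the pair spaces of the stages, so generic pairs
    above the stems approximate it. Their movers lie in the shrinking cosets and converge to an
    element moving the limit pair.\<close>
  have "\<exists>z g. (\<forall>m<i. z m = x m) \<and> (\<lambda>m. fst (z m)) \<in> C \<and> (\<lambda>m. snd (z m)) \<in> C \<and>
      g \<in> W (Suc i) \<and> F (\<lambda>m. snd (z m)) = \<phi> g (F (\<lambda>m. fst (z m)))" for i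
  proof -
    let ?P = "pair_space (N (Suc i)) (w (Suc i))"
    have "topspace ?P \<inter> (moved_by (W (Suc i)) \<inter> {z. (\<lambda>m. fst (z m)) \<in> C \<and> (\<lambda>m. snd (z m)) \<in> C}) \<noteq> {}"
      by (rule comeager_in_meets_open[OF completely_metrizable_pair_space
          comeager_in_Int[OF good comeager_pairs_in_C] openin_topspace pair_space_nonempty])
    then obtain z where z: "z \<in> topspace ?P" "z \<in> moved_by (W (Suc i))"
      "(\<lambda>m. fst (z m)) \<in> C" "(\<lambda>m. snd (z m)) \<in> C" by blast
    have "z m = x m" if "m < i" for m
    proof -
      have "m < N (Suc i)" using that N_ge[of "Suc i"] by simp
      then show ?thesis using z(1) x_eq by (simp add: in_topspace_pair_space)
    qed
    then show ?thesis using z by (auto simp: moved_by_def)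
  qed
  then obtain z g where z: "\<And>i m. m < i \<Longrightarrow> z i m = x m"
    "\<And>i. (\<lambda>m. fst (z i m)) \<in> C" "\<And>i. (\<lambda>m. snd (z i m)) \<in> C"
    and g: "\<And>i. g i \<in> W (Suc i)" "\<And>i. F (\<lambda>m. snd (z i m)) = \<phi> (g i) (F (\<lambda>m. fst (z i m)))"
    by metis
  have "g i \<in> B j (b j)" if "j \<le> i" for i j
    using g(1)[of i] W_anti[of "Suc j" "Suc i"] b[of j] that by auto
  then obtain l where l: "limitin T g l sequentially"
    using B_lim by blast
  show ?thesis
  proof
    show "l \<in> carrier H"
      using l topspace_eq_carrier by (auto simp: limitin_def)
    show "F (\<lambda>m. snd (x m)) = \<phi> l (F (\<lambda>m. fst (x m)))"
      using l g(2) z(2,3) x_C z(1) by (rule moved_by_limit)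
    have "x (N i) = (k (N i), 0)" for i
      using x_eq[of "N i" "Suc i"] N_less w_new by simp
    then have "range N \<subseteq> {n. fst (x n) = k n \<and> snd (x n) = 0}" by auto
    moreover have "infinite (range N)"
      using \<open>strict_mono N\<close> by (simp add: range_inj_infinite strict_mono_imp_inj_on)
    ultimately show "infinite {n. fst (x n) = k n \<and> snd (x n) = 0}"
      using finite_subset by blast
  qed
qed

end

section \<open>Long chains of small steps\<close>

text \<open>For symmetric \<open>V\<close> this is the subgroup generated by \<open>V\<close>. With
  new factors on the left, the quotients \<open>c (Suc i) \<otimes> inv (c i)\<close> of a chain are
  the factors themselves.\<close>

inductive_set chain_reachable :: "('a, 'm) monoid_scheme \<Rightarrow> 'a set \<Rightarrow> 'a set"
  for G (structure) and V where
    one: "\<one> \<in> chain_reachable G V"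
  | step: "\<lbrakk>g \<in> chain_reachable G V; v \<in> V\<rbrakk> \<Longrightarrow> v \<otimes> g \<in> chain_reachable G V"

context polish_group
begin

lemma chain_reachable_path:
  assumes V: "V \<subseteq> carrier G" "\<one> \<in> V" and g: "g \<in> chain_reachable G V"
  shows "\<exists>c n. c 0 = \<one> \<and> c n = g \<and> (\<forall>i. c i \<in> carrier G) \<and> (\<forall>i. c (Suc i) \<otimes> inv (c i) \<in> V)"
  using g
proof induction
  case one
  show ?case
    using V by (intro exI[of _ "\<lambda>_. \<one>"] exI[of _ 0]) simp
next
  case (step g v)
  then obtain c n where c: "c 0 = \<one>" "c n = g" "\<And>i. c i \<in> carrier G" "\<And>i. c (Suc i) \<otimes> inv (c i) \<in> V"
    by blast
  have vg: "v \<in> carrier G" "g \<in> carrier G"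
    using V step c by auto
  \<comment> \<open>The chain stays at its endpoint from \<open>Suc n\<close> on; these idle steps
    lie in \<open>V\<close> because \<open>\<one> \<in> V\<close>.\<close>
  define c' where "c' i = (if i \<le> n then c i else v \<otimes> g)" for i
  have "c' (Suc i) \<otimes> inv (c' i) \<in> V" for i
  proof -
    consider "i < n" | "i = n" | "n < i" by linarith
    then show ?thesis
    proof cases
      case 2
      have "v \<otimes> g \<otimes> inv g = v"
        using vg by (simp add: m_assoc)
      then show ?thesis using 2 c step by (simp add: c'_def)
    qed (use c V vg in \<open>auto simp: c'_def\<close>)
  qed
  moreover have "c' 0 = \<one>" "c' (Suc n) = v \<otimes> g" "\<And>i. c' i \<in> carrier G"
    using c vg by (auto simp: c'_def)
  ultimately show ?case by blast
qed

lemma chain_reachable_subgroup: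
  assumes V: "V \<subseteq> carrier G" "\<one> \<in> V" "\<And>v. v \<in> V \<Longrightarrow> inv v \<in> V"
  shows "subgroup (chain_reachable G V) G"
proof
  show sub: "chain_reachable G V \<subseteq> carrier G"
  proof
    show "g \<in> carrier G" if "g \<in> chain_reachable G V" for g
      using that by induction (use V in auto)
  qed
  show mult: "a \<otimes> b \<in> chain_reachable G V" if a: "a \<in> chain_reachable G V" and b: "b \<in> chain_reachable G V" for a b
    using a
  proof induction
    case one
    show ?case using b sub by auto
  next
    case (step a v)
    have "v \<otimes> (a \<otimes> b) \<in> chain_reachable G V"
      using step(3,2) by (rule chain_reachable.step)
    moreover have "v \<in> carrier G" "a \<in> carrier G" "b \<in> carrier G"
      using step V b sub by blast+
    ultimately show ?case by (simp add: m_assoc)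
  qed
  show "\<one> \<in> chain_reachable G V"
    by (rule chain_reachable.one)
  show "inv a \<in> chain_reachable G V" if "a \<in> chain_reachable G V" for a
    using that
  proof induction
    case one
    show ?case by (simp add: chain_reachable.one)
  next
    case (step a v)
    have "inv v \<otimes> \<one> \<in> chain_reachable G V"
      using step V(3) by (intro chain_reachable.intros)
    moreover have G: "v \<in> carrier G" "a \<in> carrier G"
      using step V sub by blast+
    ultimately have "inv a \<otimes> inv v \<in> chain_reachable G V"
      using step mult by simp
    then show ?case using G by (simp add: inv_mult_group)
  qed
qed

text \<open>Around each reachable \<open>g\<close> the translate \<open>Vg\<close> is an open set of
  reachable points.\<close>

lemma chain_reachable_openin:
  assumes V: "openin T V" "\<one> \<in> V" "\<And>v. v \<in> V \<Longrightarrow> inv v \<in> V"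
  shows "openin T (chain_reachable G V)"
proof (subst openin_subopen, intro ballI)
  fix g assume g: "g \<in> chain_reachable G V"
  have "V \<subseteq> carrier G"
    using V openin_subset_carrier by blast
  from subgroup.mem_carrier[OF chain_reachable_subgroup[OF this V(2,3)] g]
  have gG: "g \<in> carrier G" by simp
  have "openin T {x \<in> topspace T. x \<otimes> inv g \<in> V}"
    using V(1) gG by (intro openin_continuous_map_preimage[OF continuous_map_right_mult]) auto
  moreover have "g \<in> {x \<in> topspace T. x \<otimes> inv g \<in> V}"
    using gG V(2) by (simp add: topspace_eq_carrier)
  moreover have "{x \<in> topspace T. x \<otimes> inv g \<in> V} \<subseteq> chain_reachable G V"
  proof
    fix x assume x: "x \<in> {x \<in> topspace T. x \<otimes> inv g \<in> V}"
    then have "x \<otimes> inv g \<otimes> g \<in> chain_reachable G V"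
      using g by (intro chain_reachable.step) auto
    moreover have "x \<otimes> inv g \<otimes> g = x"
      using x gG by (simp add: m_assoc topspace_eq_carrier)
    ultimately show "x \<in> chain_reachable G V" by simp
  qed
  ultimately show "\<exists>U. openin T U \<and> g \<in> U \<and> U \<subseteq> chain_reachable G V" by blast
qed

lemma symmetric_neighbourhood_base:
  obtains V :: "nat \<Rightarrow> 'a set" where "\<forall>n. openin T (V n)" "\<forall>n. \<one> \<in> V n"
    "\<forall>n. \<forall>v\<in>V n. inv v \<in> V n" "\<forall>U. openin T U \<and> \<one> \<in> U \<longrightarrow> (\<exists>N. \<forall>n\<ge>N. V n \<subseteq> U)"
proof -
  obtain \<B> where B: "countable \<B>" "\<forall>V \<in> \<B>. openin T V"
     "\<forall>U x. openin T U \<and> x \<in> U \<longrightarrow> (\<exists>V \<in> \<B>. x \<in> V \<and> V \<subseteq> U)"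
    using polish_topology_second_countable[OF polish] unfolding second_countable_def
    by (elim exE conjE) (rule that)
  define D where "D = from_nat_into (insert (topspace T) {V \<in> \<B>. \<one> \<in> V})"
  have range_D: "range D = insert (topspace T) {V \<in> \<B>. \<one> \<in> V}"
    unfolding D_def using B(1) by (intro range_from_nat_into) auto
  have D: "openin T (D i)" "\<one> \<in> D i" for i
    using rangeI[of D i] B(2) openin_topspace[of T] unfolding range_D topspace_eq_carrier by auto
  \<comment> \<open>Intersecting the basic neighbourhoods up to index \<open>n\<close> with their
    inverses makes \<open>V n\<close> symmetric and decreasing in \<open>n\<close>.\<close>
  define V where "V n = {x \<in> topspace T. \<forall>i\<le>n. x \<in> D i \<and> inv x \<in> D i}" for n :: nat
  show ?thesis
  proof
    show "\<forall>n. openin T (V n)"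
    proof
      fix n
      have "openin T (\<Inter>i\<in>{..n}. D i \<inter> {x \<in> topspace T. inv x \<in> D i})"
        using D(1) openin_continuous_map_preimage[OF continuous_inv]
        by (intro openin_INT2 openin_Int) auto
      moreover have "(\<Inter>i\<in>{..n}. D i \<inter> {x \<in> topspace T. inv x \<in> D i}) = V n"
        by (auto simp: V_def)
      ultimately show "openin T (V n)" by simp
    qed
    show "\<forall>n. \<one> \<in> V n"
      using D(2) by (simp add: V_def topspace_eq_carrier)
    show "\<forall>n. \<forall>v\<in>V n. inv v \<in> V n"
      by (simp add: V_def topspace_eq_carrier)
    show "\<forall>U. openin T U \<and> \<one> \<in> U \<longrightarrow> (\<exists>N. \<forall>n\<ge>N. V n \<subseteq> U)"
    proof (intro allI impI)
      fix U assume "openin T U \<and> \<one> \<in> U"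
      then obtain A where A: "A \<in> \<B>" "\<one> \<in> A" "A \<subseteq> U"
        using B(3) by blast
      then have "A \<in> range D" by (simp add: range_D)
      then obtain N where "D N = A" by blast
      then show "\<exists>N. \<forall>n\<ge>N. V n \<subseteq> U"
        using A(3) by (intro exI[of _ N]) (auto simp: V_def)
    qed
  qed
qed

end

section \<open>Coding sequences of numbers into the group and refuting the reduction\<close>

lemma measurable_borel_of_continuous_map:
  assumes "continuous_map X Y f"
  shows "f \<in> borel_of X \<rightarrow>\<^sub>M borel_of Y"
  unfolding borel_of_def[of Y]
proof (rule measurable_measure_of)
  show "{U. openin Y U} \<subseteq> Pow (topspace Y)"
    by (auto dest: openin_subset)
  show "f \<in> space (borel_of X) \<rightarrow> topspace Y"
    using assms by (auto simp: continuous_map_def)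
  fix U assume "U \<in> {U. openin Y U}"
  then have "openin X {x \<in> topspace X. f x \<in> U}"
    using assms by (auto intro: openin_continuous_map_preimage)
  moreover have "f -` U \<inter> space (borel_of X) = {x \<in> topspace X. f x \<in> U}"
    by auto
  ultimately show "f -` U \<inter> space (borel_of X) \<in> sets (borel_of X)"
    by (simp add: sets_borel_of sigma_sets.Basic)
qed

theorem theorem1p3:
  fixes G :: "('g, 'm) monoid_scheme" and TG :: "'g topology"
    and H :: "('h, 'n) monoid_scheme" and TH :: "'h topology"
    and Y :: "'y topology" and \<phi> :: "'h \<Rightarrow> 'y \<Rightarrow> 'y"
  assumes "polish_group G TG"
    and "polish_group H TH"
    and "non_archimedean H TH"
    and "\<not> non_archimedean G TG"
    and "polish_H_space H TH Y \<phi>"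
  shows "\<not> borel_reducible (seq_topology TG) (group_conv_rel G TG) Y (orbit_rel H Y \<phi>)"
proof
  assume "borel_reducible (seq_topology TG) (group_conv_rel G TG) Y (orbit_rel H Y \<phi>)"
  then obtain f where f: "f \<in> borel_of (seq_topology TG) \<rightarrow>\<^sub>M borel_of Y"
    and red: "\<And>x y. \<lbrakk>x \<in> topspace (seq_topology TG); y \<in> topspace (seq_topology TG)\<rbrakk> \<Longrightarrow>
      (x, y) \<in> group_conv_rel G TG \<longleftrightarrow> (f x, f y) \<in> orbit_rel H Y \<phi>"
    unfolding borel_reducible_def by blast
  interpret G: polish_group G TG by fact
  interpret HY: polish_H_space H TH Y \<phi> by fact
  obtain U where U: "openin TG U" "\<one>\<^bsub>G\<^esub> \<in> U" "\<And>K. \<lbrakk>subgroup K G; openin TG K\<rbrakk> \<Longrightarrow> \<not> K \<subseteq> U"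
    using assms(4) unfolding non_archimedean_def by blast
  obtain V :: "nat \<Rightarrow> 'g set" where V: "\<forall>n. openin TG (V n)" "\<forall>n. \<one>\<^bsub>G\<^esub> \<in> V n"
    "\<forall>n. \<forall>v\<in>V n. inv\<^bsub>G\<^esub> v \<in> V n" "\<forall>U. openin TG U \<and> \<one>\<^bsub>G\<^esub> \<in> U \<longrightarrow> (\<exists>N. \<forall>n\<ge>N. V n \<subseteq> U)"
    by (rule G.symmetric_neighbourhood_base) (rule that)
  have VG: "V n \<subseteq> carrier G" for n
    using V(1) G.openin_subset_carrier by blast
  have "\<exists>c k. c 0 = \<one>\<^bsub>G\<^esub> \<and> c k \<notin> U \<and> (\<forall>i. c i \<in> carrier G) \<and>
      (\<forall>i. c (Suc i) \<otimes>\<^bsub>G\<^esub> inv\<^bsub>G\<^esub> (c i) \<in> V n)" for n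
  proof -
    \<comment> \<open>Otherwise the reachable set would be an open subgroup inside
      \<open>U\<close>.\<close>
    have "\<not> chain_reachable G (V n) \<subseteq> U"
      using V by (intro U(3) G.chain_reachable_subgroup G.chain_reachable_openin VG) auto
    then obtain g where "g \<in> chain_reachable G (V n)" "g \<notin> U" by blast
    then show ?thesis
      using G.chain_reachable_path[OF VG] V(2) by metis
  qed
  then obtain c k where c: "\<And>n. c n 0 = \<one>\<^bsub>G\<^esub>" "\<And>n. c n (k n) \<notin> U" "\<And>n i. c n i \<in> carrier G"
      "\<And>n i. c n (Suc i) \<otimes>\<^bsub>G\<^esub> inv\<^bsub>G\<^esub> (c n i) \<in> V n"
    by metis
  \<comment> \<open>The chain condition bounds upward steps; symmetry of \<open>V n\<close> covers
    downward ones.\<close>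
  have c_adjacent: "c n i \<otimes>\<^bsub>G\<^esub> inv\<^bsub>G\<^esub> (c n j) \<in> V n" if adj: "adjacent i j" for n i j
  proof -
    consider "i = j" | "i = Suc j" | "j = Suc i"
      using adj unfolding adjacent_def by linarith
    then show ?thesis
    proof cases
      case 3
      have "inv\<^bsub>G\<^esub> (c n (Suc i) \<otimes>\<^bsub>G\<^esub> inv\<^bsub>G\<^esub> (c n i)) \<in> V n"
        using c(4) V(3) by blast
      then show ?thesis
        using 3 c(3) by (simp add: G.inv_mult_group)
    qed (use c V(2) in auto)
  qed
  \<comment> \<open>The interleaved ones force every limit of quotients to be \<open>\<one>\<close>.\<close>
  define \<Phi> where "\<Phi> x n = (if even n then \<one>\<^bsub>G\<^esub> else c (n div 2) (x (n div 2)))" for x :: "nat \<Rightarrow> nat" and n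
  have \<Phi>_closed: "\<Phi> x \<in> topspace (seq_topology TG)" for x
    using c(3) by (auto simp: \<Phi>_def G.topspace_eq_carrier PiE_iff)
  have \<Phi>_continuous: "continuous_map baire_space (seq_topology TG) \<Phi>"
    unfolding continuous_map_componentwise_UNIV
  proof
    fix n
    have "continuous_map baire_space TG ((\<lambda>i. if even n then \<one>\<^bsub>G\<^esub> else c (n div 2) i) \<circ> (\<lambda>x. x (n div 2)))"
      unfolding seq_space_def
      by (rule continuous_map_compose[OF continuous_map_product_projection])
        (auto simp: c(3) G.topspace_eq_carrier)
    then show "continuous_map baire_space TG (\<lambda>x. \<Phi> x n)"
      by (simp add: o_def \<Phi>_def)
  qed
  define F where "F x = f (\<Phi> x)" for x
  have "f \<circ> \<Phi> \<in> borel_of baire_space \<rightarrow>\<^sub>M borel_of Y"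
    using measurable_borel_of_continuous_map[OF \<Phi>_continuous] f by (rule measurable_comp)
  then have F: "F \<in> borel_of baire_space \<rightarrow>\<^sub>M borel_of Y"
    by (simp add: o_def F_def[abs_def])
  have F_closed: "F x \<in> topspace Y" for x
    using measurable_space[OF F, of x] by simp
  have F_bp: "baire_property baire_space {x \<in> topspace baire_space. F x \<in> W}" if "openin Y W" for W
  proof -
    have "F -` W \<inter> space (borel_of baire_space) \<in> sets (borel_of baire_space)"
      using that by (intro measurable_sets[OF F]) (simp add: sets_borel_of sigma_sets.Basic)
    moreover have "F -` W \<inter> space (borel_of baire_space) = {x \<in> topspace baire_space. F x \<in> W}"
      by auto
    ultimately show ?thesis
      by (simp add: baire_property_borel)
  qed
  obtain C where C: "comeager_in baire_space C" "continuous_map (subtopology baire_space C) Y F"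
    by (rule continuous_on_comeager[OF polish_topology_second_countable[OF HY.polish_space] F_closed F_bp])
  have F_adjacent: "\<exists>g\<in>carrier H. F y = \<phi> g (F x)" if adj: "\<And>m. n \<le> m \<Longrightarrow> adjacent (x m) (y m)" for n x y
  proof -
    have "limitin TG (\<lambda>m. \<Phi> x m \<otimes>\<^bsub>G\<^esub> inv\<^bsub>G\<^esub> (\<Phi> y m)) \<one>\<^bsub>G\<^esub> sequentially"
      unfolding limitin_sequentially
    proof (intro conjI allI impI)
      show "\<one>\<^bsub>G\<^esub> \<in> topspace TG" by (simp add: G.topspace_eq_carrier)
      fix W assume W: "openin TG W \<and> \<one>\<^bsub>G\<^esub> \<in> W"
      then obtain N where N: "\<And>i. i \<ge> N \<Longrightarrow> V i \<subseteq> W"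
        using V(4) by blast
      \<comment> \<open>Odd entries \<open>m\<close> use the chain with index
        \<open>m div 2\<close>, whence the factor 2.\<close>
      have "\<Phi> x m \<otimes>\<^bsub>G\<^esub> inv\<^bsub>G\<^esub> (\<Phi> y m) \<in> W" if "2 * max n N \<le> m" for m
      proof -
        have "n \<le> m div 2" "N \<le> m div 2" using that by auto
        then show ?thesis
          using N[of "m div 2"] c_adjacent[OF adj, of "m div 2" "m div 2"] W by (auto simp: \<Phi>_def)
      qed
      then show "\<exists>N. \<forall>m\<ge>N. \<Phi> x m \<otimes>\<^bsub>G\<^esub> inv\<^bsub>G\<^esub> (\<Phi> y m) \<in> W" by blast
    qed
    then have "(\<Phi> x, \<Phi> y) \<in> group_conv_rel G TG"
      using \<Phi>_closed unfolding group_conv_rel_def by blast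
    then have "(F x, F y) \<in> orbit_rel H Y \<phi>"
      using red[OF \<Phi>_closed \<Phi>_closed] by (simp add: F_def)
    then show ?thesis
      by (auto simp: orbit_rel_def orbit_def)
  qed
  interpret orbit_homomorphism H TH Y \<phi> F C
    by unfold_locales (use assms(3) F_closed F_adjacent C in blast)+
  obtain x y g where g: "g \<in> carrier H" "F y = \<phi> g (F x)" and inf: "infinite {n. x n = k n \<and> y n = 0}"
    by (rule orbit_equivalent_far_apart)
  have "(F x, F y) \<in> orbit_rel H Y \<phi>"
    using g F_closed unfolding orbit_rel_def orbit_def by blast
  then have "(\<Phi> x, \<Phi> y) \<in> group_conv_rel G TG"
    using red[OF \<Phi>_closed \<Phi>_closed] by (simp add: F_def)
  then obtain l where l: "limitin TG (\<lambda>m. \<Phi> x m \<otimes>\<^bsub>G\<^esub> inv\<^bsub>G\<^esub> (\<Phi> y m)) l sequentially"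
    unfolding group_conv_rel_def by blast
  have "limitin TG ((\<lambda>m. \<Phi> x m \<otimes>\<^bsub>G\<^esub> inv\<^bsub>G\<^esub> (\<Phi> y m)) \<circ> (\<lambda>m. 2 * m)) l sequentially"
    by (rule limitin_subsequence[OF _ l]) (simp add: strict_mono_def)
  then have "limitin TG (\<lambda>m. \<one>\<^bsub>G\<^esub>) l sequentially"
    by (simp add: o_def \<Phi>_def)
  moreover have "limitin TG (\<lambda>m. \<one>\<^bsub>G\<^esub>) \<one>\<^bsub>G\<^esub> sequentially"
    by (simp add: limitin_const_iff G.topspace_eq_carrier)
  ultimately have "l = \<one>\<^bsub>G\<^esub>"
    by (rule limitin_Hausdorff_unique) (simp_all add: polish_topology_Hausdorff[OF G.polish])
  then obtain N where N: "\<And>m. m \<ge> N \<Longrightarrow> \<Phi> x m \<otimes>\<^bsub>G\<^esub> inv\<^bsub>G\<^esub> (\<Phi> y m) \<in> U"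
    using l U(1,2) unfolding limitin_sequentially by blast
  \<comment> \<open>At such an \<open>n\<close> the odd entry compares the exit
    \<open>c n (k n)\<close> with the start \<open>\<one>\<close>, so the quotient is outside
    \<open>U\<close> although it should already be inside.\<close>
  obtain n where n: "n \<ge> N" "x n = k n" "y n = 0"
    using inf unfolding infinite_nat_iff_unbounded_le by blast
  have "\<Phi> x (2 * n + 1) \<otimes>\<^bsub>G\<^esub> inv\<^bsub>G\<^esub> (\<Phi> y (2 * n + 1)) = c n (k n)"
    using n c(1,3) by (simp add: \<Phi>_def)
  then show False
    using N[of "2 * n + 1"] c(2)[of n] n(1) by simp
qed

end
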